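(* Let $n\ge1$ and $m\ge n+1$. Then there exists a proper holomorphic map from $\mathbb{B}^n$ to $D^{III}_m$ that does not extend $C^2$-smoothly to any open piece of $\partial\mathbb{B}^n$; in particular it is not a holomorphic isometry.
   Context: $\mathbb{B}^n=\{z\in\mathbb{C}^n:|z|^2<1\}$; $D^{III}_m=\{Z\in M(m,m;\mathbb{C}): Z=Z^t,\ I_m-Z\overline{Z}^t>0\}$, with Bergman kernel $c(\det(I_m-Z\overline{Z}^t))^{-(m+1)}$. Bergman metric $\omega_\Omega=\sqrt{-1}\partial\bar\partial\log K_\Omega$; a holomorphic $F:D\to\Omega$ is a holomorphic isometry if $F^*\omega_\Omega=\lambda\omega_D$ for a constant $\lambda>0$. Proper means preimages of compact sets are compact. *)

theory Defs
  imports "HOL-Analysis.Analysis"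
begin

definition cvscale :: "complex \<Rightarrow> complex^'n \<Rightarrow> complex^'n" where
  "cvscale c v = (\<chi> i. c * v$i)"

definition cmscale :: "complex \<Rightarrow> complex^'m^'k \<Rightarrow> complex^'m^'k" where
  "cmscale c A = (\<chi> i j. c * A$i$j)"

definition conj_transpose :: "complex^'m^'m \<Rightarrow> complex^'m^'m" where
  "conj_transpose A = (\<chi> i j. cnj (A$j$i))"

definition herm_pos_def :: "complex^'m^'m \<Rightarrow> bool" where
  "herm_pos_def A \<longleftrightarrow> conj_transpose A = A \<and>
     (\<forall>v::complex^'m. v \<noteq> 0 \<longrightarrow> 0 < Re (\<Sum>i\<in>UNIV. cnj (v$i) * (A *v v)$i))"

definition unit_ball :: "(complex^'n) set" where
  "unit_ball = ball 0 1"

definition typeIII_domain :: "(complex^'m^'m) set" where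
  "typeIII_domain = {Z. transpose Z = Z \<and> herm_pos_def (mat 1 - Z ** conj_transpose Z)}"

definition holo_map :: "(complex^'n \<Rightarrow> complex^'m^'k) \<Rightarrow> (complex^'n) set \<Rightarrow> bool" where
  "holo_map F U \<longleftrightarrow> (\<forall>z\<in>U. \<exists>L. (F has_derivative L) (at z) \<and>
                         (\<forall>v. L (cvscale \<i> v) = cmscale \<i> (L v)))"

definition proper_into :: "('a::topological_space \<Rightarrow> 'b::topological_space) \<Rightarrow> 'a set \<Rightarrow> 'b set \<Rightarrow> bool" where
  "proper_into F A B \<longleftrightarrow> F ` A \<subseteq> B \<and> (\<forall>K. K \<subseteq> B \<and> compact K \<longrightarrow> compact (A \<inter> F -` K))"

definition C2_on :: "('a::real_normed_vector set) \<Rightarrow> ('a \<Rightarrow> 'b::real_normed_vector) \<Rightarrow> bool" where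
  "C2_on U G \<longleftrightarrow> (\<exists>G' G''. (\<forall>x\<in>U. (G has_derivative blinfun_apply (G' x)) (at x) \<and>
                                     (G' has_derivative blinfun_apply (G'' x)) (at x))
                          \<and> continuous_on U G'')"

definition C2_extends_to_boundary_piece :: "(complex^'n \<Rightarrow> complex^'m^'m) \<Rightarrow> bool" where
  "C2_extends_to_boundary_piece F \<longleftrightarrow>
     (\<exists>U. open U \<and> U \<inter> sphere 0 1 \<noteq> {} \<and>
          (\<exists>G. C2_on U G \<and> (\<forall>z\<in>U \<inter> ball 0 1. G z = F z)))"

definition ball_bergman :: "complex^'n \<Rightarrow> real" where
  "ball_bergman z = (fact CARD('n) / pi ^ CARD('n)) * (1 - norm z ^ 2) powr (- (real CARD('n) + 1))"

definition typeIII_bergman :: "complex^'m^'m \<Rightarrow> real" where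
  "typeIII_bergman Z = (Re (det (mat 1 - Z ** conj_transpose Z))) powr (- (real CARD('m) + 1))"

text \<open>Diagonal of the Levi form: 4 * (d/dt d/dtbar) phi(z + t v) at t = 0, i.e. the Laplacian in t.\<close>
definition levi_diag :: "(complex^'n \<Rightarrow> real) \<Rightarrow> complex^'n \<Rightarrow> complex^'n \<Rightarrow> real" where
  "levi_diag \<phi> z v =
     deriv (deriv (\<lambda>s::real. \<phi> (z + cvscale (complex_of_real s) v))) 0
   + deriv (deriv (\<lambda>s::real. \<phi> (z + cvscale (\<i> * complex_of_real s) v))) 0"

text \<open>Holomorphic isometry from B^n to D^III_m w.r.t. Bergman metrics: F^* omega_D = lambda omega_B.\<close>
definition holomorphic_isometry :: "(complex^'n \<Rightarrow> complex^'m^'m) \<Rightarrow> bool" where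
  "holomorphic_isometry F \<longleftrightarrow> holo_map F unit_ball \<and> F ` unit_ball \<subseteq> typeIII_domain \<and>
     (\<exists>c>0. \<forall>z\<in>unit_ball. \<forall>v.
         levi_diag (\<lambda>w. ln (typeIII_bergman (F w))) z v = c * levi_diag (\<lambda>w. ln (ball_bergman w)) z v)"

end

theory Submission
  imports Defs "HOL-Complex_Analysis.Cauchy_Integral_Formula"
begin

unbundle no fps_syntax

text \<open>
  The ball \<open>B\<^sup>n\<close> embeds properly in \<open>D\<^sup>I\<^sup>I\<^sup>I\<^sub>n\<close> by an explicit rational map \<open>Z\<close>, coming from the
  Siegel half space slice \<open>[[\<tau>, u\<^sup>T], [u, \<i> I]]\<close>. The boundary of \<open>D\<^sup>I\<^sup>I\<^sup>I\<^sub>m\<close> contains complex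
  discs, so for \<open>m > n\<close> the map \<open>F = Z \<oplus> h \<oplus> 0\<close> is still proper for every holomorphic \<open>h\<close> with
  \<open>|h| < 1\<close>. Take \<open>h z = \<Sum>\<^sub>k 2\<^sup>-\<^sup>k\<^sup>-\<^sup>2 (1 - \<langle>z, \<zeta>\<^sub>k\<rangle>\<^sup>2)\<^sup>1\<^sup>/\<^sup>2\<close> with \<open>(\<zeta>\<^sub>k)\<close> dense in the sphere. The radial
  derivative of the real part of each term is bounded above and that of the \<open>k\<close>-th term tends
  to \<open>-\<infinity>\<close> at \<open>\<zeta>\<^sub>k\<close>, so singularities cannot cancel and \<open>h\<close> has no differentiable extension
  near any boundary point. As \<open>h\<close> is even, it has a critical point at 0; comparing the Bergman metrics along a
  coordinate disc at 0 and elsewhere then shows that \<open>F\<close> is an isometry only if \<open>h\<close> is constant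
  on that disc.
\<close>

section \<open>A proper rational map on matrices\<close>

lemma norm_vec_power2: "(norm (x::complex^'n))\<^sup>2 = (\<Sum>i\<in>UNIV. (cmod (x$i))\<^sup>2)"
  by (simp add: norm_vec_def L2_set_def sum_nonneg)

text \<open>Symmetry makes \<open>conj_transpose Z\<close> the entrywise conjugate of
  \<open>Z\<close>, so the Hermitian form of \<open>mat 1 - Z ** conj_transpose Z\<close> at
  \<open>v\<close> equals \<open>|v|^2 - |Z (cv v)|^2\<close>, with \<open>cv\<close> the
  conjugation of vectors. Since \<open>cv\<close> is a norm-preserving involution, positivity says
  exactly that \<open>Z\<close> strictly shrinks every nonzero vector.\<close>

lemma typeIII_domain_iff:
  fixes Z :: "complex^'m^'m"
  shows "Z \<in> typeIII_domain \<longleftrightarrow>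
    transpose Z = Z \<and> (\<forall>w. w \<noteq> 0 \<longrightarrow> (norm (Z *v w))\<^sup>2 < (norm w)\<^sup>2)"
proof (cases "transpose Z = Z")
  case True
  have sym: "Z$i$j = Z$j$i" for i j
  proof -
    have "transpose Z $ i $ j = Z$j$i" by (simp add: transpose_def)
    then show ?thesis by (simp only: True)
  qed
  define cv :: "complex^'m \<Rightarrow> complex^'m" where "cv v = (\<chi> i. cnj (v$i))" for v
  have cvcv: "cv (cv v) = v" for v
    by (simp add: cv_def vec_eq_iff)
  have ncv: "(norm (cv v))\<^sup>2 = (norm v)\<^sup>2" for v
    by (simp add: norm_vec_power2 cv_def)
  have herm: "conj_transpose (mat 1 - Z ** conj_transpose Z) = mat 1 - Z ** conj_transpose Z"
    by (auto simp: conj_transpose_def vec_eq_iff matrix_matrix_mult_def mat_def mult.commute)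
  have quad: "Re (\<Sum>i\<in>UNIV. cnj (v$i) * ((mat 1 - Z ** conj_transpose Z) *v v)$i)
      = (norm v)\<^sup>2 - (norm (Z *v cv v))\<^sup>2" for v
  proof -
    have mv: "((mat 1 - Z ** conj_transpose Z) *v v)$i
        = v$i - (\<Sum>k\<in>UNIV. Z$i$k * cnj ((Z *v cv v)$k))" for i
    proof -
      have "((mat 1 - Z ** conj_transpose Z) *v v) = v - Z *v (conj_transpose Z *v v)"
        by (simp add: matrix_vector_mult_diff_rdistrib matrix_vector_mul_assoc)
      moreover have "(conj_transpose Z *v v)$k = cnj ((Z *v cv v)$k)" for k
        by (simp add: matrix_vector_mult_def conj_transpose_def cv_def sym[of k])
      ultimately show ?thesis
        by (simp add: matrix_vector_mult_def)
    qed
    have "(\<Sum>i\<in>UNIV. cnj (v$i) * ((mat 1 - Z ** conj_transpose Z) *v v)$i)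
       = (\<Sum>i\<in>UNIV. cnj (v$i) * v$i)
         - (\<Sum>i\<in>UNIV. \<Sum>k\<in>UNIV. cnj (v$i) * (Z$i$k * cnj ((Z *v cv v)$k)))"
      by (simp add: mv right_diff_distrib sum_subtractf sum_distrib_left)
    also have "(\<Sum>i\<in>UNIV. \<Sum>k\<in>UNIV. cnj (v$i) * (Z$i$k * cnj ((Z *v cv v)$k)))
        = (\<Sum>k\<in>UNIV. \<Sum>i\<in>UNIV. Z$k$i * cnj (v$i) * cnj ((Z *v cv v)$k))"
      by (subst sum.swap) (simp add: sym mult_ac)
    also have "\<dots> = (\<Sum>k\<in>UNIV. (Z *v cv v)$k * cnj ((Z *v cv v)$k))"
      by (simp add: matrix_vector_mult_def cv_def sum_distrib_right)
    finally have "(\<Sum>i\<in>UNIV. cnj (v$i) * ((mat 1 - Z ** conj_transpose Z) *v v)$i)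
       = of_real ((norm v)\<^sup>2 - (norm (Z *v cv v))\<^sup>2)"
      by (simp add: norm_vec_power2 complex_norm_square mult.commute del: of_real_power)
    then show ?thesis by simp
  qed
  have "(\<forall>v. v \<noteq> 0 \<longrightarrow> (norm (Z *v cv v))\<^sup>2 < (norm v)\<^sup>2)
     \<longleftrightarrow> (\<forall>w. w \<noteq> 0 \<longrightarrow> (norm (Z *v w))\<^sup>2 < (norm w)\<^sup>2)"
    by (metis cvcv ncv norm_eq_zero power_eq_0_iff zero_eq_power2)
  then show ?thesis
    unfolding typeIII_domain_def mem_Collect_eq herm_pos_def_def quad using True herm by simp
qed (simp add: typeIII_domain_def)

text \<open>In block form \<open>[[c, x\<^sup>T], [x, -x x\<^sup>T / (1 - c)]] \<oplus> [\<eta>] \<oplus> 0\<close>, with \<open>c\<close> at position \<open>a\<close>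
  and \<open>\<eta>\<close> at position \<open>b\<close>. The first block is the Cayley transform of
  \<open>[[\<tau>, u\<^sup>T], [u, \<i> I]]\<close>, which lies in the Siegel upper half space iff \<open>Im \<tau> > |Im u|\<^sup>2\<close>; in the
  coordinate \<open>\<tau> + \<i> u\<^sup>T u / 2\<close> this is the unbounded realization of the ball.\<close>
definition siegel_block :: "'m \<Rightarrow> 'm \<Rightarrow> complex \<Rightarrow> complex^'m \<Rightarrow> complex \<Rightarrow> complex^'m^'m" where
  "siegel_block a b c x \<eta> = (\<chi> j k.
     if j = a then (if k = a then c else x$k)
     else if k = a then x$j
     else if j = b \<and> k = b then \<eta>
     else - x$j * x$k / (1 - c))"

lemma transpose_siegel_block: "transpose (siegel_block a b c x \<eta>) = siegel_block a b c x \<eta>"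
  by (simp add: siegel_block_def transpose_def vec_eq_iff mult.commute)

text \<open>Since \<open>x\<close> vanishes at \<open>a\<close> and \<open>b\<close>, the image of
  \<open>w\<close> splits into three orthogonal pieces: the entry at \<open>a\<close>, the entry at
  \<open>b\<close>, and a scalar multiple of \<open>x\<close>. This reduces contraction to an
  inequality between a few scalars.\<close>

lemma norm_siegel_block_mult:
  fixes x w :: "complex^'m"
  assumes "a \<noteq> b" "x$a = 0" "x$b = 0"
  defines "t \<equiv> \<Sum>k\<in>UNIV. x$k * w$k"
  shows "(norm (siegel_block a b c x \<eta> *v w))\<^sup>2 =
    (cmod (c * w$a + t))\<^sup>2 + (cmod (\<eta> * w$b))\<^sup>2 + (norm x)\<^sup>2 * (cmod (w$a - t / (1 - c)))\<^sup>2"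
proof -
  have ent: "(siegel_block a b c x \<eta> *v w)$j =
      (if j = a then c * w$a + t else if j = b then \<eta> * w$b else x$j * (w$a - t / (1 - c)))" for j
  proof -
    consider "j = a" | "j = b" | "j \<noteq> a" "j \<noteq> b" by blast
    then show ?thesis
    proof cases
      case 1
      have "(\<Sum>k\<in>UNIV. (if k = a then c else x$k) * w$k)
          = (\<Sum>k\<in>UNIV. (if k = a then c * w$a else 0) + x$k * w$k)"
        by (rule sum.cong) (auto simp: assms)
      also have "\<dots> = c * w$a + t"
        by (simp add: sum.distrib t_def)
      finally show ?thesis
        using 1 by (simp add: matrix_vector_mult_def siegel_block_def)
    next
      case 2
      have "(siegel_block a b c x \<eta> *v w)$j = (\<Sum>k\<in>UNIV. if k = b then \<eta> * w$b else 0)"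
        unfolding matrix_vector_mult_def siegel_block_def vec_lambda_beta
        by (rule sum.cong) (use 2 assms in auto)
      then show ?thesis using 2 assms by simp
    next
      case 3
      have "(siegel_block a b c x \<eta> *v w)$j
          = (\<Sum>k\<in>UNIV. (if k = a then x$j * w$a else 0) + (- x$j / (1 - c)) * (x$k * w$k))"
        unfolding matrix_vector_mult_def siegel_block_def vec_lambda_beta
        by (rule sum.cong) (use 3 assms in auto)
      also have "\<dots> = x$j * w$a + (- x$j / (1 - c)) * t"
        by (simp only: sum.distrib t_def sum_distrib_left) simp
      finally show ?thesis using 3 by (simp add: right_diff_distrib)
    qed
  qed
  have "(norm (siegel_block a b c x \<eta> *v w))\<^sup>2 =
     (\<Sum>j\<in>UNIV. (if j = a then (cmod (c * w$a + t))\<^sup>2 else 0) +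
       (if j = b then (cmod (\<eta> * w$b))\<^sup>2 else 0) + (cmod (x$j))\<^sup>2 * (cmod (w$a - t / (1 - c)))\<^sup>2)"
    unfolding norm_vec_power2 ent
    by (rule sum.cong) (use assms in \<open>auto simp: norm_mult power_mult_distrib\<close>)
  also have "\<dots> = (cmod (c * w$a + t))\<^sup>2 + (cmod (\<eta> * w$b))\<^sup>2
      + (norm x)\<^sup>2 * (cmod (w$a - t / (1 - c)))\<^sup>2"
    by (simp add: sum.distrib norm_vec_power2 sum_distrib_right)
  finally show ?thesis .
qed

text \<open>With \<open>d = a - t / (1 - c)\<close>, the difference of the two sides times \<open>r\<close> is at least
  \<open>(|t| - r |d|)\<^sup>2 + r |d|\<^sup>2 (1 - |c|\<^sup>2 - 2 r)\<close>.\<close>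
lemma siegel_form_less:
  fixes a t c :: complex and r \<beta> :: real
  assumes less1: "(cmod c)\<^sup>2 + 2 * r < 1" and "r \<ge> 0" "\<beta> \<ge> 0" and t: "(cmod t)\<^sup>2 \<le> r * \<beta>"
    and nz: "a \<noteq> 0 \<or> \<beta> \<noteq> 0"
  shows "(cmod (c * a + t))\<^sup>2 + r * (cmod (a - t / (1 - c)))\<^sup>2 < (cmod a)\<^sup>2 + \<beta>"
proof -
  define q where "q = 1 - c"
  define d where "d = a - t / q"
  have "cmod c < 1"
    using less1 \<open>r \<ge> 0\<close> by (smt (verit) norm_ge_zero one_power2 power_mono)
  then have "q \<noteq> 0"
    using norm_one by (auto simp: q_def)
  have td: "t = q * (a - d)"
    using \<open>q \<noteq> 0\<close> by (simp add: d_def)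
  have ca: "c * a + t = a - q * d"
    by (simp add: td q_def algebra_simps)
  have \<delta>: "1 - (cmod c)\<^sup>2 = 2 * Re q - (cmod q)\<^sup>2"
    unfolding cmod_power2 by (simp add: q_def power2_eq_square algebra_simps)
  have "(cmod a)\<^sup>2 - (cmod (a - q * d))\<^sup>2
      = 2 * Re (cnj t * d * (q / cnj q)) + (cmod d)\<^sup>2 * (2 * Re q - (cmod q)\<^sup>2)"
  proof -
    have "cnj t * d * (q / cnj q) = cnj (a - d) * d * q"
      using \<open>q \<noteq> 0\<close> by (simp add: td)
    then show ?thesis
      unfolding cmod_power2 by (simp only:) (simp add: power2_eq_square algebra_simps)
  qed
  \<comment> \<open>\<open>q / cnj q\<close> is a mere phase, so the cross term is bounded by
    \<open>|t| |d|\<close>.\<close>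
  moreover have "\<bar>Re (cnj t * d * (q / cnj q))\<bar> \<le> cmod t * cmod d"
    using abs_Re_le_cmod[of "cnj t * d * (q / cnj q)"] \<open>q \<noteq> 0\<close>
    by (simp add: norm_mult norm_divide)
  ultimately have main: "(cmod a)\<^sup>2 + \<beta> - (cmod (c * a + t))\<^sup>2 - r * (cmod d)\<^sup>2
      \<ge> \<beta> - 2 * cmod t * cmod d + r * (cmod d)\<^sup>2 + (cmod d)\<^sup>2 * (1 - (cmod c)\<^sup>2 - 2 * r)"
    unfolding ca \<delta> by (simp add: algebra_simps)
  have "\<beta> - 2 * cmod t * cmod d + r * (cmod d)\<^sup>2 \<ge> 0"
  proof (cases "r = 0")
    case True
    then show ?thesis using t \<open>\<beta> \<ge> 0\<close> by simp
  next
    case False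
    then have "r > 0" using \<open>r \<ge> 0\<close> by simp
    have "0 \<le> (cmod t - r * cmod d)\<^sup>2" by simp
    also have "\<dots> \<le> r * (\<beta> - 2 * cmod t * cmod d + r * (cmod d)\<^sup>2)"
      using t by (simp add: power2_eq_square algebra_simps)
    finally show ?thesis
      using \<open>r > 0\<close> by (simp only: zero_le_mult_iff) auto
  qed
  moreover have "(cmod d)\<^sup>2 * (1 - (cmod c)\<^sup>2 - 2 * r) > 0" if "d \<noteq> 0"
    using that less1 by simp
  \<comment> \<open>For \<open>d = 0\<close> the gain proportional to \<open>|d|^2\<close> is lost
    and strictness has to come from \<open>\<beta>\<close>.\<close>
  moreover have "\<beta> > 0" if "d = 0"
  proof (rule ccontr)
    assume "\<not> \<beta> > 0"
    then have "\<beta> = 0" using \<open>\<beta> \<ge> 0\<close> by simp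
    then have "t = 0" using t by simp
    then have "a = 0" using that by (simp add: d_def)
    then show False using nz \<open>\<beta> = 0\<close> by simp
  qed
  ultimately have "\<beta> - 2 * cmod t * cmod d + r * (cmod d)\<^sup>2
      + (cmod d)\<^sup>2 * (1 - (cmod c)\<^sup>2 - 2 * r) > 0"
    by (cases "d = 0") auto
  then show ?thesis
    using main unfolding d_def q_def by linarith
qed

text \<open>The coordinate \<open>b\<close> decouples and only needs \<open>|\<eta>| < 1\<close>.
  For the rest, \<open>siegel_form_less\<close> applies with \<open>r = |x|^2\<close> and
  \<open>\<beta>\<close> the squared norm of \<open>w\<close> off \<open>a\<close> and
  \<open>b\<close>; its hypothesis on \<open>t\<close> is Cauchy-Schwarz.\<close>

lemma siegel_block_in_typeIII_domain:
  fixes x :: "complex^'m"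
  assumes ab: "a \<noteq> b" "x$a = 0" "x$b = 0"
    and less1: "(cmod c)\<^sup>2 + 2 * (norm x)\<^sup>2 < 1" and \<eta>: "cmod \<eta> < 1"
  shows "siegel_block a b c x \<eta> \<in> typeIII_domain"
  unfolding typeIII_domain_iff
proof (intro conjI allI impI)
  fix w :: "complex^'m"
  assume "w \<noteq> 0"
  define t where "t = (\<Sum>k\<in>UNIV. x$k * w$k)"
  define \<beta> where "\<beta> = (\<Sum>k\<in>-{a,b}. (cmod (w$k))\<^sup>2)"
  have "\<beta> \<ge> 0" by (simp add: \<beta>_def sum_nonneg)
  have split: "(\<Sum>k\<in>UNIV. f k) = f a + f b + (\<Sum>k\<in>-{a,b}. f k)" for f :: "'m \<Rightarrow> real"
  proof -
    have "(\<Sum>k\<in>UNIV. f k) = (\<Sum>k\<in>{a,b}. f k) + (\<Sum>k\<in>-{a,b}. f k)"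
      by (metis Compl_disjoint Compl_partition finite sum.union_disjoint)
    then show ?thesis using ab by simp
  qed
  have w2: "(norm w)\<^sup>2 = (cmod (w$a))\<^sup>2 + (cmod (w$b))\<^sup>2 + \<beta>"
    by (simp add: norm_vec_power2 split \<beta>_def)
  have x2: "(norm x)\<^sup>2 = (\<Sum>k\<in>-{a,b}. (cmod (x$k))\<^sup>2)"
    using ab by (simp add: norm_vec_power2 split)
  have "cmod t \<le> (\<Sum>k\<in>UNIV. cmod (x$k) * cmod (w$k))"
    unfolding t_def by (rule order_trans[OF norm_sum]) (simp add: norm_mult)
  also have "\<dots> = (\<Sum>k\<in>-{a,b}. cmod (x$k) * cmod (w$k))"
    using ab by (simp add: split)
  finally have "(cmod t)\<^sup>2 \<le> (\<Sum>k\<in>-{a,b}. cmod (x$k) * cmod (w$k))\<^sup>2"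
    by (simp add: power_mono)
  also have "\<dots> \<le> (norm x)\<^sup>2 * \<beta>"
    unfolding x2 \<beta>_def by (rule Cauchy_Schwarz_ineq_sum)
  finally have t: "(cmod t)\<^sup>2 \<le> (norm x)\<^sup>2 * \<beta>" .
  have *: "(norm (siegel_block a b c x \<eta> *v w))\<^sup>2 = (cmod (c * w$a + t))\<^sup>2
      + (norm x)\<^sup>2 * (cmod (w$a - t / (1 - c)))\<^sup>2 + (cmod \<eta>)\<^sup>2 * (cmod (w$b))\<^sup>2"
    using norm_siegel_block_mult[OF ab, of c \<eta> w]
    by (simp add: t_def norm_mult power_mult_distrib)
  have \<eta>2: "(cmod \<eta>)\<^sup>2 < 1"
    using \<eta> by (simp add: power_less_one_iff abs_square_less_1)
  show "(norm (siegel_block a b c x \<eta> *v w))\<^sup>2 < (norm w)\<^sup>2"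
  \<comment> \<open>If \<open>w\<close> is supported at \<open>b\<close>, the Siegel part gives only
    equality and strictness comes from \<open>\<eta>\<close>; otherwise it comes from the Siegel
    part.\<close>
  proof (cases "w$a = 0 \<and> \<beta> = 0")
    case True
    then have "t = 0" "w$b \<noteq> 0"
      using t w2 \<open>w \<noteq> 0\<close> by auto
    then show ?thesis
      using True \<eta>2 by (simp add: * w2)
  next
    case False
    then have "(cmod (c * w$a + t))\<^sup>2 + (norm x)\<^sup>2 * (cmod (w$a - t / (1 - c)))\<^sup>2
        < (cmod (w$a))\<^sup>2 + \<beta>"
      by (intro siegel_form_less less1 t \<open>\<beta> \<ge> 0\<close>) auto
    moreover have "(cmod \<eta>)\<^sup>2 * (cmod (w$b))\<^sup>2 \<le> (cmod (w$b))\<^sup>2"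
      using \<eta>2 by (simp add: mult_left_le_one_le)
    ultimately show ?thesis
      by (simp add: * w2)
  qed
qed (rule transpose_siegel_block)

text \<open>The extremal vector for \<open>siegel_form_less\<close>: off \<open>a\<close> it is
  proportional to the conjugate of \<open>x\<close>, and with \<open>q = 1 - c\<close> it has
  \<open>d = cnj q\<close> and \<open>t = - q |x|^2\<close>, so that every estimate there becomes an
  equality.\<close>

definition siegel_test_vec :: "'m \<Rightarrow> complex \<Rightarrow> complex^'m \<Rightarrow> complex^'m" where
  "siegel_test_vec a c x =
     (\<chi> j. if j = a then cnj (1 - c) - of_real ((norm x)\<^sup>2) else - (1 - c) * cnj (x$j))"

lemma norm_siegel_test_vec:
  assumes "x$a = 0"
  shows "(norm (siegel_test_vec a c x))\<^sup>2 =
    (cmod (cnj (1 - c) - of_real ((norm x)\<^sup>2)))\<^sup>2 + (cmod (1 - c))\<^sup>2 * (norm x)\<^sup>2"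
proof -
  have "(norm (siegel_test_vec a c x))\<^sup>2 =
     (\<Sum>j\<in>UNIV. (if j = a then (cmod (cnj (1 - c) - of_real ((norm x)\<^sup>2)))\<^sup>2 else 0)
        + (cmod (1 - c))\<^sup>2 * (cmod (x$j))\<^sup>2)"
    unfolding norm_vec_power2[of "siegel_test_vec a c x"]
    by (rule sum.cong) (use assms in \<open>auto simp: siegel_test_vec_def norm_mult power_mult_distrib
          norm_minus_commute[of c 1]\<close>)
  then show ?thesis
    by (simp add: sum.distrib norm_vec_power2[of x] sum_distrib_left)
qed

lemma siegel_test_vec_nonzero:
  assumes "x$a = 0" "c \<noteq> 1"
  shows "siegel_test_vec a c x \<noteq> 0"
proof
  assume "siegel_test_vec a c x = 0"
  then have z: "(cmod (cnj (1 - c) - of_real ((norm x)\<^sup>2)))\<^sup>2 + (cmod (1 - c))\<^sup>2 * (norm x)\<^sup>2 = 0"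
    using norm_siegel_test_vec[of x a c] assms by simp
  then have "(cmod (1 - c))\<^sup>2 * (norm x)\<^sup>2 = 0"
    by (smt (verit) mult_nonneg_nonneg zero_le_power2)
  then have "x = 0" using assms by simp
  then show False using z assms by simp
qed

text \<open>The loss of norm along the test vector is \<open>|1 - c|^2\<close> times the defining
  function of the ball in the coordinates \<open>c\<close> and \<open>sqrt 2 x\<close>. The entry
  \<open>\<eta>\<close> drops out because the vector is zero at \<open>b\<close>. Properness rests
  on this identity.\<close>

lemma siegel_block_test_vec:
  fixes x :: "complex^'m"
  assumes ab: "a \<noteq> b" "x$a = 0" "x$b = 0" and "c \<noteq> 1"
  defines "w \<equiv> siegel_test_vec a c x"
  shows "(norm w)\<^sup>2 - (norm (siegel_block a b c x \<eta> *v w))\<^sup>2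
    = (cmod (1 - c))\<^sup>2 * (1 - (cmod c)\<^sup>2 - 2 * (norm x)\<^sup>2)"
proof -
  define q where "q = 1 - c"
  define r where "r = (norm x)\<^sup>2"
  have "q \<noteq> 0" using \<open>c \<noteq> 1\<close> by (simp add: q_def)
  have "(\<Sum>k\<in>UNIV. x$k * w$k) = (\<Sum>k\<in>UNIV. - q * of_real ((cmod (x$k))\<^sup>2))"
    by (rule sum.cong) (use ab in \<open>auto simp: w_def siegel_test_vec_def q_def complex_norm_square
        algebra_simps simp del: of_real_power\<close>)
  then have t: "(\<Sum>k\<in>UNIV. x$k * w$k) = - q * of_real r"
    by (simp add: r_def norm_vec_power2 sum_distrib_left sum_negf)
  have wa: "w$a = cnj q - of_real r" "w$b = 0"
    using ab by (simp_all add: w_def siegel_test_vec_def q_def r_def)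
  have c: "c = 1 - q" by (simp add: q_def)
  have "(norm (siegel_block a b c x \<eta> *v w))\<^sup>2
      = (cmod ((1 - q) * (cnj q - of_real r) - q * of_real r))\<^sup>2 + r * (cmod q)\<^sup>2"
    using norm_siegel_block_mult[OF ab, of c \<eta> w] \<open>q \<noteq> 0\<close>
    by (simp add: t wa r_def[symmetric] c)
  also have "(1 - q) * (cnj q - of_real r) - q * of_real r = (cnj q - of_real r) - of_real ((cmod q)\<^sup>2)"
    by (simp add: complex_norm_square algebra_simps del: of_real_power)
  finally have 1: "(norm (siegel_block a b c x \<eta> *v w))\<^sup>2
      = (cmod ((cnj q - of_real r) - of_real ((cmod q)\<^sup>2)))\<^sup>2 + r * (cmod q)\<^sup>2" .
  have 2: "(norm w)\<^sup>2 = (cmod (cnj q - of_real r))\<^sup>2 + r * (cmod q)\<^sup>2"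
    using norm_siegel_test_vec[of x a c] ab by (simp add: w_def q_def r_def)
  have "(cmod (cnj q - of_real r))\<^sup>2 - (cmod ((cnj q - of_real r) - of_real ((cmod q)\<^sup>2)))\<^sup>2
     = (cmod q)\<^sup>2 * (2 * (Re q - r) - (cmod q)\<^sup>2)"
  proof -
    have "(cmod u)\<^sup>2 - (cmod (u - of_real s))\<^sup>2 = s * (2 * Re u - s)" for u s
      unfolding cmod_power2 by (simp add: power2_eq_square algebra_simps)
    from this[of "cnj q - of_real r" "(cmod q)\<^sup>2"] show ?thesis by simp
  qed
  moreover have "1 - (cmod c)\<^sup>2 = 2 * Re q - (cmod q)\<^sup>2"
    unfolding cmod_power2 by (simp add: c power2_eq_square algebra_simps)
  ultimately have "(norm w)\<^sup>2 - (norm (siegel_block a b c x \<eta> *v w))\<^sup>2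
    = (cmod q)\<^sup>2 * (1 - (cmod c)\<^sup>2 - 2 * r)"
    unfolding 1 2 by simp
  then show ?thesis
    unfolding q_def r_def .
qed

section \<open>A singular holomorphic function on the ball\<close>

definition cplx_diff :: "(complex^'n \<Rightarrow> complex) \<Rightarrow> complex^'n \<Rightarrow> bool" where
  "cplx_diff f z \<longleftrightarrow> (\<exists>L. (f has_derivative L) (at z) \<and> (\<forall>v. L (cvscale \<i> v) = \<i> * L v))"

lemma cplx_diff_const: "cplx_diff (\<lambda>z. c) z"
  unfolding cplx_diff_def by (intro exI[of _ "\<lambda>v. 0"]) auto

lemma cplx_diff_nth: "cplx_diff (\<lambda>z. z$i) z"
  unfolding cplx_diff_def
  by (intro exI[of _ "\<lambda>v. v$i"])
    (auto simp: cvscale_def intro: bounded_linear_imp_has_derivative bounded_linear_vec_nth)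

lemma cplx_diff_mult:
  assumes "cplx_diff f z" "cplx_diff g z"
  shows "cplx_diff (\<lambda>z. f z * g z) z"
proof -
  obtain L M where L: "(f has_derivative L) (at z)" "\<And>v. L (cvscale \<i> v) = \<i> * L v"
    and M: "(g has_derivative M) (at z)" "\<And>v. M (cvscale \<i> v) = \<i> * M v"
    using assms unfolding cplx_diff_def by blast
  show ?thesis
    unfolding cplx_diff_def
    by (intro exI[of _ "\<lambda>v. f z * M v + L v * g z"] conjI has_derivative_mult L M)
      (simp add: L M algebra_simps)
qed

lemma cplx_diff_compose:
  assumes "cplx_diff f z" "g field_differentiable at (f z)"
  shows "cplx_diff (\<lambda>z. g (f z)) z"
proof -
  obtain L where L: "(f has_derivative L) (at z)" "\<And>v. L (cvscale \<i> v) = \<i> * L v"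
    using assms unfolding cplx_diff_def by blast
  obtain D where "(g has_derivative (*) D) (at (f z))"
    using assms unfolding field_differentiable_def has_field_derivative_def by blast
  from has_derivative_compose[OF L(1) this]
  have "((\<lambda>z. g (f z)) has_derivative (\<lambda>v. D * L v)) (at z)" .
  then show ?thesis
    unfolding cplx_diff_def using L(2) by (auto intro!: exI[of _ "\<lambda>v. D * L v"])
qed

lemma has_derivative_vec_lambda:
  fixes f :: "'i::finite \<Rightarrow> 'a::real_normed_vector \<Rightarrow> 'b::euclidean_space"
  assumes "\<And>i. (f i has_derivative f' i) (at x)"
  shows "((\<lambda>x. \<chi> i. f i x) has_derivative (\<lambda>h. \<chi> i. f' i h)) (at x)"
  unfolding has_derivative_componentwise_within[of "\<lambda>x. \<chi> i. f i x"]
  using assms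
  by (auto simp: Basis_vec_def inner_axis intro!: has_derivative_inner_left)

text \<open>Entrywise derivatives assemble to a matrix-valued one, and commuting with multiplication
  by \<open>\<i>\<close> is an entrywise condition.\<close>

lemma holo_mapI:
  assumes "\<And>z i j. z \<in> U \<Longrightarrow> cplx_diff (\<lambda>z. F z $ i $ j) z"
  shows "holo_map F U"
  unfolding holo_map_def
proof
  fix z assume "z \<in> U"
  then obtain L where L: "\<And>i j. ((\<lambda>z. F z $ i $ j) has_derivative L i j) (at z)"
    "\<And>i j v. L i j (cvscale \<i> v) = \<i> * L i j v"
    using assms unfolding cplx_diff_def by metis
  have "((\<lambda>z. \<chi> i j. F z $ i $ j) has_derivative (\<lambda>h. \<chi> i j. L i j h)) (at z)"
    by (intro has_derivative_vec_lambda L)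
  then show "\<exists>L. (F has_derivative L) (at z) \<and> (\<forall>v. L (cvscale \<i> v) = cmscale \<i> (L v))"
    by (intro exI[of _ "\<lambda>h. \<chi> i j. L i j h"]) (simp add: L cmscale_def)
qed

text \<open>On a complex line, a real linear map commuting with \<open>\<i>\<close> is
  multiplication by its value at the unit vector. This opens one-variable theory on coordinate
  discs.\<close>

lemma cplx_diff_axis_field_differentiable:
  assumes "cplx_diff f (axis i w)"
  shows "(\<lambda>w. f (axis i w)) field_differentiable at w"
proof -
  obtain L where L: "(f has_derivative L) (at (axis i w))" "\<And>v. L (cvscale \<i> v) = \<i> * L v"
    using assms unfolding cplx_diff_def by blast
  have "((\<lambda>w::complex. axis i w) has_derivative (\<lambda>h. axis i h)) (at w)"
    by (auto intro!: bounded_linear_imp_has_derivative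
        simp: linear_conv_bounded_linear[symmetric] linear_iff axis_def vec_eq_iff)
  from has_derivative_compose[OF this L(1)]
  have d: "((\<lambda>w. f (axis i w)) has_derivative (\<lambda>h. L (axis i h))) (at w)" .
  have "bounded_linear L" using L(1) by (rule has_derivative_bounded_linear)
  then interpret bounded_linear L .
  have "L (axis i h) = L (axis i 1) * h" for h
  proof -
    have "axis i h = Re h *\<^sub>R axis i 1 + Im h *\<^sub>R cvscale \<i> (axis i (1::complex))"
      by (simp add: vec_eq_iff axis_def cvscale_def complex_eq_iff)
    then have "L (axis i h) = Re h *\<^sub>R L (axis i 1) + Im h *\<^sub>R (\<i> * L (axis i 1))"
      by (simp add: add scaleR L)
    then have "L (axis i h) = of_real (Re h) * L (axis i 1) + of_real (Im h) * (\<i> * L (axis i 1))"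
      by (simp only: scaleR_conv_of_real)
    then show ?thesis
      by (subst (3) complex_eq) (simp add: algebra_simps)
  qed
  then have "(\<lambda>h. L (axis i h)) = (*) (L (axis i 1))"
    by (intro ext)
  then show ?thesis
    using d unfolding field_differentiable_def has_field_derivative_def by metis
qed

text \<open>Termwise differentiation: the bounds \<open>M n\<close> make the series of derivatives
  converge uniformly on \<open>S\<close> in operator norm (Weierstrass M-test), and complex
  linearity passes to the sum.\<close>

lemma cplx_diff_series:
  fixes f :: "nat \<Rightarrow> complex^'n \<Rightarrow> complex"
  assumes "convex S" "open S" "z0 \<in> S"
    and deriv: "\<And>n z. z \<in> S \<Longrightarrow> (f n has_derivative L n z) (at z)"
    and lin: "\<And>n z v. z \<in> S \<Longrightarrow> L n z (cvscale \<i> v) = \<i> * L n z v"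
    and bd: "\<And>n z v. z \<in> S \<Longrightarrow> cmod (L n z v) \<le> M n * norm v"
    and "summable M" "summable (\<lambda>n. f n z0)"
  shows "cplx_diff (\<lambda>z. \<Sum>n. f n z) z0"
proof -
  have sL: "summable (\<lambda>n. L n z v)" if "z \<in> S" for z v
    using summable_mult2[OF \<open>summable M\<close>] bd[OF that] by (rule summable_comparison_test')
  have "\<exists>g. \<forall>z\<in>S. (\<lambda>n. f n z) sums (g z) \<and> (g has_derivative (\<lambda>v. \<Sum>n. L n z v)) (at z within S)"
  proof (rule has_derivative_series)
    show "convex S" "z0 \<in> S" by fact+
    show "(f n has_derivative L n z) (at z within S)" if "z \<in> S" for n z
      by (rule has_derivative_at_withinI[OF deriv[OF that]])
    show "(\<lambda>n. f n z0) sums (\<Sum>n. f n z0)"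
      using assms by (simp add: summable_sums)
    fix e :: real assume "e > 0"
    from suminf_exist_split[OF this \<open>summable M\<close>]
    obtain N where N: "\<And>n. n \<ge> N \<Longrightarrow> norm (\<Sum>i. M (i + n)) < e" by blast
    show "\<forall>\<^sub>F n in sequentially. \<forall>z\<in>S. \<forall>v. cmod ((\<Sum>i<n. L i z v) - (\<Sum>i. L i z v)) \<le> e * norm v"
      unfolding eventually_sequentially
    proof (intro exI allI ballI impI)
      fix n z and v :: "complex^'n" assume n: "n \<ge> N" and z: "z \<in> S"
      have sM: "summable (\<lambda>i. M (i + n) * norm v)"
        using \<open>summable M\<close> by (simp add: summable_mult2 summable_ignore_initial_segment)
      have "(\<Sum>i. L i z v) = (\<Sum>i. L (i + n) z v) + (\<Sum>i<n. L i z v)"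
        by (rule suminf_split_initial_segment[OF sL[OF z]])
      then have "cmod ((\<Sum>i<n. L i z v) - (\<Sum>i. L i z v)) = cmod (\<Sum>i. L (i + n) z v)"
        by (simp add: norm_minus_commute)
      also have "\<dots> \<le> (\<Sum>i. M (i + n) * norm v)"
        by (rule norm_suminf_le[OF _ sM]) (simp add: bd z)
      also have "\<dots> = (\<Sum>i. M (i + n)) * norm v"
        using \<open>summable M\<close> by (simp add: suminf_mult2 summable_ignore_initial_segment)
      also have "\<dots> \<le> e * norm v"
        using N[OF n] by (intro mult_right_mono) auto
      finally show "cmod ((\<Sum>i<n. L i z v) - (\<Sum>i. L i z v)) \<le> e * norm v" .
    qed
  qed
  then obtain g where g: "\<And>z. z \<in> S \<Longrightarrow> (\<lambda>n. f n z) sums (g z)"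
    and dg: "\<And>z. z \<in> S \<Longrightarrow> (g has_derivative (\<lambda>v. \<Sum>n. L n z v)) (at z within S)"
    by blast
  have "(g has_derivative (\<lambda>v. \<Sum>n. L n z0 v)) (at z0)"
    using dg[OF \<open>z0 \<in> S\<close>] unfolding at_within_open[OF \<open>z0 \<in> S\<close> \<open>open S\<close>] .
  then have "((\<lambda>z. \<Sum>n. f n z) has_derivative (\<lambda>v. \<Sum>n. L n z0 v)) (at z0)"
    by (rule has_derivative_transform_within_open[OF _ \<open>open S\<close> \<open>z0 \<in> S\<close>])
      (use g in \<open>auto simp: sums_iff\<close>)
  moreover have "(\<Sum>n. L n z0 (cvscale \<i> v)) = \<i> * (\<Sum>n. L n z0 v)" for v
    unfolding lin[OF \<open>z0 \<in> S\<close>] by (rule suminf_mult[OF sL[OF \<open>z0 \<in> S\<close>]])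
  ultimately show ?thesis
    unfolding cplx_diff_def by blast
qed

section \<open>The Hermitian product, linear in its first argument, and the square-root
  series\<close>

definition cdot :: "complex^'n \<Rightarrow> complex^'n \<Rightarrow> complex" where
  "cdot z w = (\<Sum>i\<in>UNIV. z$i * cnj (w$i))"

lemma norm_cdot_le: "cmod (cdot z w) \<le> norm z * norm w"
proof -
  have "cmod (cdot z w) \<le> (\<Sum>i\<in>UNIV. cmod (z$i) * cmod (w$i))"
    unfolding cdot_def by (rule order_trans[OF norm_sum]) (simp add: norm_mult)
  also have "\<dots> \<le> norm z * norm w"
    unfolding norm_vec_def using L2_set_mult_ineq[of "\<lambda>i. cmod (z$i)" "\<lambda>i. cmod (w$i)" UNIV] by simp
  finally show ?thesis .
qed

lemma cdot_self: "cdot z z = of_real ((norm z)\<^sup>2)"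
  by (simp add: cdot_def norm_vec_power2 complex_norm_square del: of_real_power)

lemma bounded_linear_cdot: "bounded_linear (\<lambda>z. cdot z w)"
  unfolding cdot_def
  by (intro bounded_linear_sum bounded_linear_compose[OF bounded_linear_mult_left] bounded_linear_vec_nth)

lemma cdot_cvscale: "cdot (cvscale c z) w = c * cdot z w"
  by (simp add: cdot_def cvscale_def sum_distrib_left mult.assoc)

lemma cdot_scaleR: "cdot (r *\<^sub>R z) w = of_real r * cdot z w"
  by (simp add: cdot_def scaleR_sum_right flip: scaleR_conv_of_real)

lemma Re_one_minus_pos:
  assumes "cmod l < 1"
  shows "Re (1 - l) > 0"
  using complex_Re_le_cmod[of l] assms by simp

text \<open>The weights start at 1/4 and sum to 1/2, while each root has modulus at most
  \<open>sqrt 2\<close> on the ball; hence the sum stays below 1 in modulus. Squaring the product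
  makes every term even in \<open>z\<close>.\<close>

definition sqrt_series :: "(nat \<Rightarrow> complex^'n) \<Rightarrow> complex^'n \<Rightarrow> complex" where
  "sqrt_series \<zeta> z = (\<Sum>k. (1/2)^(k+2) * csqrt (1 - (cdot z (\<zeta> k))\<^sup>2))"

lemma summable_half: "summable (\<lambda>k. (1/2::real)^(k+2))"
  by (subst summable_iff_shift) simp

lemma suminf_half: "(\<Sum>k. (1/2::real)^(k+2)) = 1/2"
  using suminf_geometric[of "1/2::real"]
  by (subst suminf_minus_initial_segment) (simp_all add: eval_nat_numeral)

context
  fixes \<zeta> :: "nat \<Rightarrow> complex^'n"
  assumes \<zeta>: "\<And>k. norm (\<zeta> k) = 1"
begin

lemma norm_cdot_less: "norm z < 1 \<Longrightarrow> cmod ((cdot z (\<zeta> k))\<^sup>2) < 1"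
proof -
  assume "norm z < 1"
  then have "cmod (cdot z (\<zeta> k)) < 1"
    using norm_cdot_le[of z "\<zeta> k"] by (simp add: \<zeta>)
  then show ?thesis by (simp add: norm_power abs_square_less_1)
qed

lemma sqrt_series_term_le:
  assumes "norm z < 1"
  shows "cmod ((1/2)^(k+2) * csqrt (1 - (cdot z (\<zeta> k))\<^sup>2)) \<le> sqrt 2 * (1/2)^(k+2)"
proof -
  have "cmod (1 - (cdot z (\<zeta> k))\<^sup>2) \<le> 2"
    using norm_triangle_ineq4[of 1 "(cdot z (\<zeta> k))\<^sup>2"] norm_cdot_less[OF assms, of k] by simp
  then show ?thesis
    by (simp add: norm_mult norm_power norm_divide field_simps)
qed

lemma summable_sqrt_series:
  assumes "norm z < 1"
  shows "summable (\<lambda>k. (1/2)^(k+2) * csqrt (1 - (cdot z (\<zeta> k))\<^sup>2))"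
  by (rule summable_comparison_test'[where g = "\<lambda>k. sqrt 2 * (1/2)^(k+2)"])
    (intro summable_mult summable_half, use sqrt_series_term_le[OF assms] in blast)

lemma norm_sqrt_series_less:
  assumes "norm z < 1"
  shows "cmod (sqrt_series \<zeta> z) < 1"
proof -
  have "cmod (sqrt_series \<zeta> z) \<le> (\<Sum>k. sqrt 2 * (1/2)^(k+2))"
    unfolding sqrt_series_def
    by (rule norm_suminf_le[OF sqrt_series_term_le[OF assms]]) (intro summable_mult summable_half)
  also have "\<dots> = sqrt 2 * (1/2)"
    using suminf_mult[OF summable_half, of "sqrt 2"] suminf_half by simp
  also have "\<dots> < 1"
    using sqrt2_less_2 by simp
  finally show ?thesis .
qed

text \<open>The derivatives of the terms blow up at the sphere, so termwise differentiation is
  carried out on a smaller ball of radius \<open>\<rho>\<close>. There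
  \<open>|1 - l^2| \<ge> 1 - \<rho>^2\<close>, which bounds the reciprocal roots by \<open>C\<close>
  uniformly in \<open>k\<close>.\<close>

lemma cplx_diff_sqrt_series:
  assumes "norm z < 1"
  shows "cplx_diff (sqrt_series \<zeta>) z"
proof -
  obtain \<rho> where \<rho>: "norm z < \<rho>" "\<rho> < 1"
    using dense assms by blast
  have "\<rho> > 0" using \<rho> by (smt (verit) norm_ge_zero)
  define C where "C = 1 / sqrt (1 - \<rho>\<^sup>2)"
  define L where "L k z v = - ((1/2)^(k+2) * (cdot z (\<zeta> k) * cdot v (\<zeta> k)
      / csqrt (1 - (cdot z (\<zeta> k))\<^sup>2)))" for k and z v :: "complex^'n"
  have "cplx_diff (\<lambda>z. \<Sum>k. (1/2)^(k+2) * csqrt (1 - (cdot z (\<zeta> k))\<^sup>2)) z"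
  proof (rule cplx_diff_series[where S = "ball 0 \<rho>" and L = L and M = "\<lambda>k. C * (1/2)^(k+2)"])
    fix k and y :: "complex^'n" assume y: "y \<in> ball 0 \<rho>"
    define l where "l = cdot y (\<zeta> k)"
    have l: "cmod l < \<rho>"
      using y norm_cdot_le[of y "\<zeta> k"] by (simp add: \<zeta> l_def)
    have "cmod (l\<^sup>2) < 1"
      using norm_cdot_less[of y k] y \<rho> by (simp add: l_def)
    \<comment> \<open>The radicand has positive real part, hence avoids the branch cut of
      \<open>csqrt\<close>.\<close>
    then have "1 - l\<^sup>2 \<notin> \<real>\<^sub>\<le>\<^sub>0"
      using Re_one_minus_pos[of "l\<^sup>2"] by (auto simp: complex_nonpos_Reals_iff)
    then have "((\<lambda>l. (1/2)^(k+2) * csqrt (1 - l\<^sup>2)) has_field_derivative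
        - ((1/2)^(k+2) * (l / csqrt (1 - l\<^sup>2)))) (at l)"
      by (auto intro!: derivative_eq_intros)
    from has_derivative_compose[OF bounded_linear_imp_has_derivative[OF bounded_linear_cdot]
        this[unfolded has_field_derivative_def l_def]]
    show "((\<lambda>z. (1/2)^(k+2) * csqrt (1 - (cdot z (\<zeta> k))\<^sup>2)) has_derivative L k y) (at y)"
      by (simp add: L_def[abs_def] l_def mult.assoc)
    show "L k y (cvscale \<i> v) = \<i> * L k y v" for v
      by (simp add: L_def cdot_cvscale)
    have "1 - \<rho>\<^sup>2 \<le> cmod (1 - l\<^sup>2)"
    proof -
      have "cmod (l\<^sup>2) \<le> \<rho>\<^sup>2" using l by (simp add: norm_power power_mono)
      then show ?thesis using norm_triangle_ineq2[of 1 "l\<^sup>2"] by simp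
    qed
    moreover have "\<rho>\<^sup>2 < 1" using \<rho> \<open>\<rho> > 0\<close> by (simp add: abs_square_less_1)
    ultimately have C: "1 / cmod (csqrt (1 - l\<^sup>2)) \<le> C"
      unfolding C_def by (simp add: frac_le)
    fix v :: "complex^'n"
    have "cmod l * cmod (cdot v (\<zeta> k)) \<le> 1 * norm v"
      using l \<rho> norm_cdot_le[of v "\<zeta> k"] by (intro mult_mono) (auto simp: \<zeta>)
    then have "cmod l * cmod (cdot v (\<zeta> k)) * (1 / cmod (csqrt (1 - l\<^sup>2))) \<le> norm v * C"
      using C by (intro mult_mono) auto
    then have "(1/2)^(k+2) * (cmod l * cmod (cdot v (\<zeta> k)) * (1 / cmod (csqrt (1 - l\<^sup>2))))
        \<le> (1/2)^(k+2) * (norm v * C)"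
      by (intro mult_left_mono) auto
    moreover have "cmod (L k y v)
        = (1/2)^(k+2) * (cmod l * cmod (cdot v (\<zeta> k)) * (1 / cmod (csqrt (1 - l\<^sup>2))))"
      by (simp add: L_def l_def norm_mult norm_divide norm_power)
    ultimately show "cmod (L k y v) \<le> C * (1/2)^(k+2) * norm v"
      by (simp only: mult_ac)
  next
    show "summable (\<lambda>k. C * (1/2)^(k+2))"
      by (intro summable_mult summable_half)
    show "summable (\<lambda>k. (1/2)^(k+2) * csqrt (1 - (cdot z (\<zeta> k))\<^sup>2))"
      by (rule summable_sqrt_series[OF assms])
  qed (use \<rho> in auto)
  then show ?thesis by (simp add: sqrt_series_def[abs_def])
qed

end

text \<open>With \<open>p, q\<close> the two square roots, \<open>p - q = (s - r) l / (p + q)\<close>; here \<open>Re (1 / (p + q)) \<ge> 0\<close>,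
  while \<open>(1 - l) / (p + q)\<close> stays bounded because \<open>|1 - l| \<le> 2 |p|\<^sup>2\<close>.\<close>
lemma Re_csqrt_radial_diff_ge:
  assumes l: "cmod l \<le> 1" and rs: "0 \<le> r" "r \<le> s" "s < 1"
  shows "Re (csqrt (1 - of_real r * l)) - Re (csqrt (1 - of_real s * l)) \<ge> - 8 * (s - r)"
proof -
  define p where "p = csqrt (1 - of_real r * l)"
  define q where "q = csqrt (1 - of_real s * l)"
  have p2: "p\<^sup>2 = 1 - of_real r * l" and q2: "q\<^sup>2 = 1 - of_real s * l"
    by (simp_all add: p_def q_def)
  have rl: "cmod (of_real r * l) \<le> r"
    using mult_left_mono[OF l \<open>0 \<le> r\<close>] rs by (simp add: norm_mult)
  have "Re (p\<^sup>2) > 0"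
    unfolding p2 by (rule Re_one_minus_pos) (use rl rs in simp)
  \<comment> \<open>\<open>p\<close> lies in the sector \<open>|Im p| < Re p\<close>, so its modulus
    is comparable with its real part, and adding \<open>q\<close> with \<open>Re q \<ge> 0\<close>
    cannot cancel it.\<close>
  then have "(Re p)\<^sup>2 > (Im p)\<^sup>2"
    by (simp add: power2_eq_square)
  then have pp: "(cmod p)\<^sup>2 \<le> 2 * (Re p)\<^sup>2"
    unfolding cmod_power2 by simp
  have "Re p \<ge> 0" "Re q \<ge> 0"
    unfolding p_def q_def by (rule Re_csqrt)+
  with \<open>(Re p)\<^sup>2 > (Im p)\<^sup>2\<close> have "Re p > 0"
    by (cases "Re p = 0") (auto simp: not_less[symmetric])
  then have pq: "p + q \<noteq> 0" and Rpq: "Re p \<le> cmod (p + q)"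
    using \<open>Re q \<ge> 0\<close> complex_Re_le_cmod[of "p + q"] by (auto simp: complex_eq_iff)
  have cp: "(cmod p)\<^sup>2 = cmod (1 - of_real r * l)"
    by (metis norm_power p2)
  have "cmod (1 - of_real r * l) \<le> 2"
    using norm_triangle_ineq4[of 1 "of_real r * l"] rl rs by simp
  then have "(Re p)\<^sup>2 \<le> 2\<^sup>2"
    using abs_Re_le_cmod[of p] cp power_mono[of "\<bar>Re p\<bar>" "cmod p" 2] by simp
  then have "Re p \<le> 2"
    by (rule power2_le_imp_le) simp
  \<comment> \<open>Write \<open>1 - l = (1 - r l) - (1 - r) l\<close>; both parts are at most
    \<open>|1 - r l| = |p|^2\<close> in modulus.\<close>
  have "cmod (1 - l) \<le> cmod (1 - of_real r * l) + cmod (of_real (1 - r) * l)"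
    using norm_triangle_ineq4[of "1 - of_real r * l" "of_real (1 - r) * l"]
    by (simp add: algebra_simps)
  also have "cmod (of_real (1 - r) * l) \<le> 1 - r"
    using mult_left_mono[OF l, of "1 - r"] rs unfolding norm_mult norm_of_real by simp
  also have "1 - r \<le> cmod (1 - of_real r * l)"
    using norm_triangle_ineq2[of 1 "of_real r * l"] rl by simp
  finally have "cmod (1 - l) \<le> 2 * (cmod p)\<^sup>2"
    by (simp add: cp)
  also have "\<dots> \<le> 4 * (Re p * Re p)"
    using pp by (simp add: power2_eq_square)
  also have "\<dots> \<le> 4 * (2 * cmod (p + q))"
    using \<open>Re p \<le> 2\<close> Rpq \<open>Re p > 0\<close> by (intro mult_left_mono mult_mono) auto
  finally have "cmod ((1 - l) / (p + q)) \<le> 8"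
    using pq by (simp add: norm_divide divide_le_eq)
  then have "Re ((1 - l) / (p + q)) \<le> 8"
    using complex_Re_le_cmod order_trans by blast
  moreover have "Re (1 / (p + q)) \<ge> 0"
    using \<open>Re p > 0\<close> \<open>Re q \<ge> 0\<close> by (simp add: Re_divide)
  moreover have "l / (p + q) = 1 / (p + q) - (1 - l) / (p + q)"
    by (simp add: diff_divide_distrib)
  ultimately have "Re (l / (p + q)) \<ge> - 8"
    by simp
  moreover have "p - q = of_real (s - r) * (l / (p + q))"
  proof -
    have "(p - q) * (p + q) = p\<^sup>2 - q\<^sup>2"
      by (simp add: power2_eq_square algebra_simps)
    also have "\<dots> = of_real (s - r) * l"
      by (simp add: p2 q2 algebra_simps)
    finally show ?thesis
      using pq by (simp add: field_simps)
  qed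
  then have "Re (p - q) = (s - r) * Re (l / (p + q))"
    by (simp only: Re_complex_of_real Im_complex_of_real times_complex.simps mult_zero_left diff_zero)
  ultimately have "Re (p - q) \<ge> (s - r) * (- 8)"
    using rs mult_left_mono[of "-8" "Re (l / (p + q))" "s - r"] by simp
  then show ?thesis
    by (simp add: p_def q_def)
qed

section \<open>Radial growth of the series and failure of differentiability at the points
  \<open>\<zeta> j\<close>\<close>

context
  fixes \<zeta> :: "nat \<Rightarrow> complex^'n"
  assumes \<zeta>: "\<And>k. norm (\<zeta> k) = 1"
begin

text \<open>After a linear correction every term has a nonnegative radial decrement, so the sum
  dominates its \<open>j\<close>-th term alone. As \<open>cdot (\<zeta> j) (\<zeta> j) = 1\<close>,
  that term is the real root \<open>sqrt (1 - r^2)\<close> up to its weight.\<close>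

lemma Re_sqrt_series_radial_diff_ge:
  assumes rs: "0 \<le> r" "r \<le> s" "s < 1"
  shows "Re (sqrt_series \<zeta> (r *\<^sub>R \<zeta> j)) - Re (sqrt_series \<zeta> (s *\<^sub>R \<zeta> j))
    \<ge> (1/2)^(j+2) * (sqrt (1 - r\<^sup>2) - sqrt (1 - s\<^sup>2)) - 8 * (s - r)"
proof -
  define T where "T r k = (1/2)^(k+2) * csqrt (1 - (cdot (r *\<^sub>R \<zeta> j) (\<zeta> k))\<^sup>2)" for r k
  \<comment> \<open>The one-term bound gives 8 times \<open>s^2 - r^2\<close>, which is at most
    \<open>2 (s - r)\<close>: hence 16. Summed against weights of total 1/2, the correction is
    \<open>8 * (s - r)\<close>.\<close>
  define d where "d k = Re (T r k) - Re (T s k) + (1/2)^(k+2) * (16 * (s - r))" for k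
  have T: "T r k = of_real ((1/2)^(k+2)) * csqrt (1 - of_real (r\<^sup>2) * (cdot (\<zeta> j) (\<zeta> k))\<^sup>2)" for r k
    by (simp add: T_def cdot_scaleR power_mult_distrib)
  have sT: "T r sums sqrt_series \<zeta> (r *\<^sub>R \<zeta> j)" "T s sums sqrt_series \<zeta> (s *\<^sub>R \<zeta> j)"
    unfolding T_def sqrt_series_def
    by (intro summable_sums summable_sqrt_series \<zeta>; use rs in \<open>simp add: \<zeta>\<close>)+
  have "(\<lambda>k. (1/2::real)^(k+2)) sums (1/2)"
    using summable_half suminf_half by (simp add: sums_iff)
  moreover have eq: "1/2 * (16 * (s - r)) = 8 * (s - r)" by simp
  ultimately have "(\<lambda>k. (1/2)^(k+2) * (16 * (s - r))) sums (8 * (s - r))"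
    using sums_mult2[of "\<lambda>k. (1/2)^(k+2)" "1/2" "16 * (s - r)"] by (simp only: eq)
  from sums_add[OF sums_diff[OF sums_Re[OF sT(1)] sums_Re[OF sT(2)]] this]
  have sd: "d sums (Re (sqrt_series \<zeta> (r *\<^sub>R \<zeta> j)) - Re (sqrt_series \<zeta> (s *\<^sub>R \<zeta> j)) + 8 * (s - r))"
    unfolding d_def .
  have "s\<^sup>2 < 1" using rs by (simp add: abs_square_less_1)
  have "r\<^sup>2 \<le> s\<^sup>2" using rs by (simp add: power_mono)
  have d0: "d k \<ge> 0" for k
  proof -
    have "cmod ((cdot (\<zeta> j) (\<zeta> k))\<^sup>2) \<le> 1"
      using norm_cdot_le[of "\<zeta> j" "\<zeta> k"] by (simp add: \<zeta> norm_power power_le_one)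
    from Re_csqrt_radial_diff_ge[OF this zero_le_power2 \<open>r\<^sup>2 \<le> s\<^sup>2\<close> \<open>s\<^sup>2 < 1\<close>]
    have "Re (csqrt (1 - of_real (r\<^sup>2) * (cdot (\<zeta> j) (\<zeta> k))\<^sup>2))
        - Re (csqrt (1 - of_real (s\<^sup>2) * (cdot (\<zeta> j) (\<zeta> k))\<^sup>2)) + 8 * (s\<^sup>2 - r\<^sup>2) \<ge> 0"
      by simp
    moreover have "s\<^sup>2 - r\<^sup>2 \<le> 2 * (s - r)"
    proof -
      have "s\<^sup>2 - r\<^sup>2 = (s + r) * (s - r)" by (simp add: power2_eq_square algebra_simps)
      also have "\<dots> \<le> 2 * (s - r)" using rs by (intro mult_right_mono) auto
      finally show ?thesis .
    qed
    ultimately have "0 \<le> (1/2)^(k+2) * (Re (csqrt (1 - of_real (r\<^sup>2) * (cdot (\<zeta> j) (\<zeta> k))\<^sup>2))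
        - Re (csqrt (1 - of_real (s\<^sup>2) * (cdot (\<zeta> j) (\<zeta> k))\<^sup>2)) + 16 * (s - r))"
      by (intro mult_nonneg_nonneg) auto
    also have "\<dots> = d k"
      unfolding d_def T Re_complex_of_real Im_complex_of_real times_complex.simps
      by (simp only: ring_distribs mult_zero_left diff_zero)
    finally show ?thesis .
  qed
  have "d j \<le> (\<Sum>k. d k)"
    using sum_le_suminf[of d "{j}"] sd d0 by (auto simp: sums_iff)
  moreover have reT: "Re (T t j) = (1/2)^(j+2) * sqrt (1 - t\<^sup>2)" if "t\<^sup>2 \<le> 1" for t
  proof -
    have "csqrt (1 - of_real (t\<^sup>2) * (cdot (\<zeta> j) (\<zeta> j))\<^sup>2) = csqrt (of_real (1 - t\<^sup>2))"
      by (simp add: cdot_self \<zeta>)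
    also have "\<dots> = of_real (sqrt (1 - t\<^sup>2))"
      using that by (intro csqrt_of_real) simp
    finally show ?thesis
      unfolding T by (simp only: Re_complex_of_real Im_complex_of_real times_complex.simps mult_zero_left diff_zero)
  qed
  have "Re (T r j) - Re (T s j) = (1/2)^(j+2) * (sqrt (1 - r\<^sup>2) - sqrt (1 - s\<^sup>2))"
    using reT[of r] reT[of s] \<open>r\<^sup>2 \<le> s\<^sup>2\<close> \<open>s\<^sup>2 < 1\<close> by (simp add: right_diff_distrib)
  moreover have "d j \<ge> Re (T r j) - Re (T s j)"
    using rs by (simp add: d_def)
  ultimately show ?thesis
    using sd by (simp add: sums_iff)
qed

text \<open>Along the radius to \<open>\<zeta> j\<close> the decrement of \<open>Re g\<close> is at
  least of order \<open>sqrt (1 - r^2)\<close>, whereas differentiability allows only order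
  \<open>1 - r\<close>.\<close>

lemma sqrt_series_not_differentiable:
  assumes "\<epsilon> > 0"
    and g: "\<And>r. 0 \<le> r \<Longrightarrow> 1 - \<epsilon> < r \<Longrightarrow> r < 1 \<Longrightarrow> g (r *\<^sub>R \<zeta> j) = sqrt_series \<zeta> (r *\<^sub>R \<zeta> j)"
  shows "\<not> g differentiable at (\<zeta> j)"
proof
  assume "g differentiable at (\<zeta> j)"
  then obtain L where L: "(g has_derivative L) (at (\<zeta> j))"
    unfolding differentiable_def by blast
  then obtain K where "K > 0" and K: "\<And>v. cmod (L v) \<le> norm v * K"
    using bounded_linear.pos_bounded has_derivative_bounded_linear by blast
  define c where "c = (1/2::real)^(j+2)"
  have "c > 0" by (simp add: c_def)
  from L obtain \<delta> where "\<delta> > 0"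
    and \<delta>: "\<And>y. norm (y - \<zeta> j) < \<delta> \<Longrightarrow> cmod (g y - g (\<zeta> j) - L (y - \<zeta> j)) \<le> 1 * norm (y - \<zeta> j)"
    unfolding has_derivative_at_alt by (metis zero_less_one)
  have dist: "norm (r *\<^sub>R \<zeta> j - \<zeta> j) = \<bar>r - 1\<bar>" for r
  proof -
    have "r *\<^sub>R \<zeta> j - \<zeta> j = (r - 1) *\<^sub>R \<zeta> j" by (simp add: scaleR_diff_left)
    then show ?thesis by (simp add: \<zeta>)
  qed
  have lower: "Re (g (r *\<^sub>R \<zeta> j)) - Re (g (\<zeta> j)) \<ge> c * sqrt (1 - r\<^sup>2) - 8 * (1 - r)"
    if r: "0 \<le> r" "1 - \<epsilon> < r" "r < 1" for r
  proof -
    \<comment> \<open>The radial estimate concerns interior points; continuity of \<open>g\<close>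
      carries it to the boundary point as \<open>s\<close> tends to 1 from below.\<close>
    have "isCont g (\<zeta> j)"
      using L by (rule has_derivative_continuous)
    moreover have "((\<lambda>s. s *\<^sub>R \<zeta> j) \<longlongrightarrow> 1 *\<^sub>R \<zeta> j) (at_left 1)"
      by (intro tendsto_intros)
    ultimately have "((\<lambda>s. g (s *\<^sub>R \<zeta> j)) \<longlongrightarrow> g (\<zeta> j)) (at_left 1)"
      by (auto intro: isCont_tendsto_compose)
    then have l1: "((\<lambda>s. Re (g (r *\<^sub>R \<zeta> j)) - Re (g (s *\<^sub>R \<zeta> j))) \<longlongrightarrow>
        Re (g (r *\<^sub>R \<zeta> j)) - Re (g (\<zeta> j))) (at_left 1)"
      by (intro tendsto_intros)
    have "((\<lambda>s. c * (sqrt (1 - r\<^sup>2) - sqrt (1 - s\<^sup>2)) - 8 * (s - r)) \<longlongrightarrow>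
        c * (sqrt (1 - r\<^sup>2) - sqrt (1 - 1\<^sup>2)) - 8 * (1 - r)) (at_left 1)"
      by (intro tendsto_intros)
    then have l2: "((\<lambda>s. c * (sqrt (1 - r\<^sup>2) - sqrt (1 - s\<^sup>2)) - 8 * (s - r)) \<longlongrightarrow>
        c * sqrt (1 - r\<^sup>2) - 8 * (1 - r)) (at_left 1)"
      by simp
    have "\<forall>\<^sub>F s in at_left 1. s \<in> {r<..<1}"
      using r by (intro eventually_at_leftI) auto
    then have "\<forall>\<^sub>F s in at_left 1. c * (sqrt (1 - r\<^sup>2) - sqrt (1 - s\<^sup>2)) - 8 * (s - r)
        \<le> Re (g (r *\<^sub>R \<zeta> j)) - Re (g (s *\<^sub>R \<zeta> j))"
    proof eventually_elim
      case (elim s)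
      then show ?case
        using Re_sqrt_series_radial_diff_ge[of r s j] r g[of r] g[of s]
        by (simp add: c_def)
    qed
    then show ?thesis
      by (rule tendsto_le[OF _ l1 l2, rotated]) simp
  qed
  have upper: "Re (g (r *\<^sub>R \<zeta> j)) - Re (g (\<zeta> j)) \<le> (K + 1) * (1 - r)"
    if "1 - \<delta> < r" "r < 1" for r
  proof -
    have "Re (g (r *\<^sub>R \<zeta> j)) - Re (g (\<zeta> j)) \<le> cmod (g (r *\<^sub>R \<zeta> j) - g (\<zeta> j))"
      using complex_Re_le_cmod[of "g (r *\<^sub>R \<zeta> j) - g (\<zeta> j)"] by simp
    also have "\<dots> \<le> cmod (g (r *\<^sub>R \<zeta> j) - g (\<zeta> j) - L (r *\<^sub>R \<zeta> j - \<zeta> j)) + cmod (L (r *\<^sub>R \<zeta> j - \<zeta> j))"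
      by (metis diff_add_cancel norm_triangle_ineq)
    also have "\<dots> \<le> (1 - r) + (1 - r) * K"
      using \<delta>[of "r *\<^sub>R \<zeta> j"] K[of "r *\<^sub>R \<zeta> j - \<zeta> j"] that by (intro add_mono) (simp_all add: dist)
    finally show ?thesis by (simp add: algebra_simps)
  qed
  \<comment> \<open>Take \<open>r = 1 - u^2\<close>: then \<open>sqrt (1 - r^2) \<ge> u\<close>
    while \<open>1 - r = u^2\<close>, so the two bounds give \<open>c \<le> (K + 9) u\<close>,
    against \<open>u \<le> c / (K + 10)\<close>. The other bounds on \<open>u\<close> keep
    \<open>r\<close> in the range where both estimates hold.\<close>
  define u where "u = min (c / (K + 10)) (min (sqrt \<epsilon> / 2) (min (sqrt \<delta> / 2) (1/2)))"
  have "u > 0"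
    using \<open>c > 0\<close> \<open>K > 0\<close> \<open>\<epsilon> > 0\<close> \<open>\<delta> > 0\<close> by (simp add: u_def)
  have "u \<le> sqrt \<epsilon> / 2" "u \<le> sqrt \<delta> / 2" "u \<le> 1/2" "u \<le> c / (K + 10)"
    unfolding u_def by linarith+
  have "u\<^sup>2 \<le> (sqrt \<epsilon> / 2)\<^sup>2" "u\<^sup>2 \<le> (sqrt \<delta> / 2)\<^sup>2" "u\<^sup>2 \<le> (1/2)\<^sup>2"
    using \<open>u > 0\<close> \<open>u \<le> sqrt \<epsilon> / 2\<close> \<open>u \<le> sqrt \<delta> / 2\<close> \<open>u \<le> 1/2\<close> by (simp_all only: power_mono less_imp_le)
  then have small: "u\<^sup>2 < \<epsilon>" "u\<^sup>2 < \<delta>" "u\<^sup>2 < 1"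
    using \<open>\<epsilon> > 0\<close> \<open>\<delta> > 0\<close> by (simp_all add: power_divide)
  have "u \<le> sqrt (1 - (1 - u\<^sup>2)\<^sup>2)"
  proof (rule real_le_rsqrt)
    have "u\<^sup>2 * u\<^sup>2 \<le> u\<^sup>2 * 1"
      using small by (intro mult_left_mono) auto
    then show "u\<^sup>2 \<le> 1 - (1 - u\<^sup>2)\<^sup>2"
      by (simp add: power2_eq_square algebra_simps)
  qed
  then have "c * u - 8 * u\<^sup>2 \<le> c * sqrt (1 - (1 - u\<^sup>2)\<^sup>2) - 8 * (1 - (1 - u\<^sup>2))"
    using \<open>c > 0\<close> by simp
  also have "\<dots> \<le> (K + 1) * (1 - (1 - u\<^sup>2))"
    using lower[of "1 - u\<^sup>2"] upper[of "1 - u\<^sup>2"] small \<open>u > 0\<close> by simp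
  finally have "c * u \<le> ((K + 9) * u) * u"
    by (simp add: power2_eq_square algebra_simps)
  then have "c \<le> (K + 9) * u"
    using \<open>u > 0\<close> by simp
  moreover have "(K + 10) * u \<le> c"
    using \<open>u \<le> c / (K + 10)\<close> \<open>K > 0\<close> by (simp add: pos_le_divide_eq mult.commute)
  ultimately show False
    using \<open>u > 0\<close> by (simp add: algebra_simps)
qed

end

section \<open>Isometries along coordinate discs\<close>

definition has_second_deriv0 :: "(real \<Rightarrow> real) \<Rightarrow> real \<Rightarrow> bool" where
  "has_second_deriv0 f D \<longleftrightarrow> (\<exists>f'. (\<forall>\<^sub>F s in nhds 0. (f has_real_derivative f' s) (at s)) \<and>
     (f' has_real_derivative D) (at 0))"

text \<open>\<open>deriv\<close> is total and carries no proof of existence; the relational form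
  does. This lemma returns to the iterated \<open>deriv\<close> in \<open>levi_diag\<close>.\<close>

lemma has_second_deriv0_imp_deriv:
  assumes "has_second_deriv0 f D"
  shows "deriv (deriv f) 0 = D"
proof -
  obtain f' where f': "\<forall>\<^sub>F s in nhds 0. (f has_real_derivative f' s) (at s)"
    and D: "(f' has_real_derivative D) (at 0)"
    using assms unfolding has_second_deriv0_def by blast
  have "\<forall>\<^sub>F s in nhds 0. deriv f s = f' s"
    using f' by eventually_elim (rule DERIV_imp_deriv)
  then have "deriv (deriv f) 0 = deriv f' 0"
    by (intro deriv_cong_ev) auto
  then show ?thesis
    using D by (simp add: DERIV_imp_deriv)
qed

lemma has_second_deriv0_cong:
  assumes "has_second_deriv0 f D" "\<forall>\<^sub>F s in nhds 0. f s = g s"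
  shows "has_second_deriv0 g D"
proof -
  obtain f' where f': "\<forall>\<^sub>F s in nhds 0. (f has_real_derivative f' s) (at s)"
    and D: "(f' has_real_derivative D) (at 0)"
    using assms unfolding has_second_deriv0_def by blast
  have "\<forall>\<^sub>F s in nhds 0. \<forall>\<^sub>F t in nhds s. f t = g t"
    using assms(2) by (simp add: eventually_eventually)
  with f' have "\<forall>\<^sub>F s in nhds 0. (g has_real_derivative f' s) (at s)"
    by eventually_elim (simp add: DERIV_cong_ev)
  then show ?thesis
    using D unfolding has_second_deriv0_def by blast
qed

text \<open>The shape of the logarithm of a Bergman kernel here: a normalizing constant, an exponent
  \<open>b\<close>, and the logarithms of two factors.\<close>

lemma has_second_deriv0_affine:
  assumes "has_second_deriv0 f D" "has_second_deriv0 g E"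
  shows "has_second_deriv0 (\<lambda>s. a + b * (f s + g s)) (b * (D + E))"
proof -
  obtain f' where f': "\<forall>\<^sub>F s in nhds 0. (f has_real_derivative f' s) (at s)"
    and D: "(f' has_real_derivative D) (at 0)"
    using assms unfolding has_second_deriv0_def by blast
  obtain g' where g': "\<forall>\<^sub>F s in nhds 0. (g has_real_derivative g' s) (at s)"
    and E: "(g' has_real_derivative E) (at 0)"
    using assms unfolding has_second_deriv0_def by blast
  have "\<forall>\<^sub>F s in nhds 0. ((\<lambda>s. a + b * (f s + g s)) has_real_derivative b * (f' s + g' s)) (at s)"
    using f' g' by eventually_elim (auto intro!: derivative_eq_intros)
  moreover have "((\<lambda>s. b * (f' s + g' s)) has_real_derivative b * (D + E)) (at 0)"
    using D E by (auto intro!: derivative_eq_intros)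
  ultimately show ?thesis
    unfolding has_second_deriv0_def by (intro exI[of _ "\<lambda>s. b * (f' s + g' s)"] conjI)
qed

lemma has_second_deriv0_const: "has_second_deriv0 (\<lambda>s. a) 0"
  unfolding has_second_deriv0_def by (rule exI[of _ "\<lambda>s. 0"]) auto

text \<open>With \<open>u = |g|^2\<close> along the line, this is
  \<open>- u'' / (1 - u) - u'^2 / (1 - u)^2\<close>; here \<open>u' = 2 Re (cnj g * g' e)\<close>
  and \<open>u'' = 2 |g' e|^2 + 2 Re (cnj g * g'' e^2)\<close>.\<close>

lemma has_second_deriv0_ln_one_minus_norm:
  assumes g: "g holomorphic_on U" "open U" "w \<in> U" and less1: "\<And>z. z \<in> U \<Longrightarrow> cmod (g z) < 1"
  shows "has_second_deriv0 (\<lambda>s. ln (1 - (cmod (g (w + e * of_real s)))\<^sup>2))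
    (- (2 * (cmod (deriv g w * e))\<^sup>2 + 2 * Re (cnj (g w) * (deriv (deriv g) w * e\<^sup>2))) / (1 - (cmod (g w))\<^sup>2)
     - (2 * Re (cnj (g w) * (deriv g w * e)))\<^sup>2 / (1 - (cmod (g w))\<^sup>2)\<^sup>2)"
proof -
  define p where "p s = w + e * of_real s" for s :: real
  define G1 where "G1 s = deriv g (p s) * e" for s
  define G2 where "G2 s = deriv (deriv g) (p s) * e\<^sup>2" for s
  have pd: "(p has_vector_derivative e) (at s)" for s
    unfolding p_def by (auto intro!: derivative_eq_intros)
  have d1: "((\<lambda>s. g (p s)) has_vector_derivative G1 s) (at s)" if "p s \<in> U" for s
  proof -
    have "(g has_field_derivative deriv g (p s)) (at (p s))"
      using g that by (simp add: holomorphic_derivI)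
    from field_vector_diff_chain_at[OF pd this] show ?thesis
      by (simp add: o_def G1_def mult.commute)
  qed
  have d2: "(G1 has_vector_derivative G2 s) (at s)" if "p s \<in> U" for s
  proof -
    have "(deriv g has_field_derivative deriv (deriv g) (p s)) (at (p s))"
      by (rule holomorphic_derivI[OF holomorphic_deriv[OF g(1,2)] g(2) that])
    from field_vector_diff_chain_at[OF pd this]
    have "((\<lambda>s. deriv g (p s)) has_vector_derivative e * deriv (deriv g) (p s)) (at s)"
      by (simp add: o_def)
    then show ?thesis
      unfolding G1_def G2_def by (auto intro!: derivative_eq_intros simp: power2_eq_square)
  qed
  have re: "((\<lambda>s. Re (f s)) has_real_derivative Re f') (at s)"
       and im: "((\<lambda>s. Im (f s)) has_real_derivative Im f') (at s)"
    if "(f has_vector_derivative f') (at s)" for f f' and s :: real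
    using that has_field_derivative_Re has_field_derivative_Im by blast+
  have sq: "(cmod z)\<^sup>2 = Re z * Re z + Im z * Im z" for z
    unfolding cmod_power2 by (simp add: power2_eq_square)
  have u1: "((\<lambda>s. (cmod (g (p s)))\<^sup>2) has_real_derivative 2 * Re (cnj (g (p s)) * G1 s)) (at s)"
    if "p s \<in> U" for s
    unfolding sq
    by (rule derivative_eq_intros re im d1 that refl)+ (simp add: algebra_simps)
  have u2: "((\<lambda>s. 2 * Re (cnj (g (p s)) * G1 s)) has_real_derivative
      2 * (cmod (G1 s))\<^sup>2 + 2 * Re (cnj (g (p s)) * G2 s)) (at s)"
    if "p s \<in> U" for s
    unfolding sq times_complex.simps complex_cnj
    by (rule derivative_eq_intros re im d1 d2 that refl)+ (simp add: algebra_simps)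
  have pos: "1 - (cmod (g (p s)))\<^sup>2 > 0" if "p s \<in> U" for s
    using less1[OF that] by (simp add: abs_square_less_1)
  have "isCont p 0"
    unfolding p_def by (intro continuous_intros)
  then have "\<forall>\<^sub>F s in nhds 0. p s \<in> U"
    using g by (simp add: continuous_at_open eventually_nhds p_def)
  then have "\<forall>\<^sub>F s in nhds 0. ((\<lambda>s. ln (1 - (cmod (g (p s)))\<^sup>2)) has_real_derivative
      - (2 * Re (cnj (g (p s)) * G1 s)) / (1 - (cmod (g (p s)))\<^sup>2)) (at s)"
  proof eventually_elim
    case (elim s)
    show ?case
      by (rule derivative_eq_intros u1 elim pos refl)+ simp
  qed
  moreover have p0: "p 0 = w" by (simp add: p_def)
  then have "p 0 \<in> U" using g by simp
  then have "((\<lambda>s. - (2 * Re (cnj (g (p s)) * G1 s)) / (1 - (cmod (g (p s)))\<^sup>2)) has_real_derivative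
     (- (2 * (cmod (G1 0))\<^sup>2 + 2 * Re (cnj (g (p 0)) * G2 0)) / (1 - (cmod (g (p 0)))\<^sup>2)
     - (2 * Re (cnj (g (p 0)) * G1 0))\<^sup>2 / (1 - (cmod (g (p 0)))\<^sup>2)\<^sup>2)) (at 0)"
  proof -
    let ?A = "2 * Re (cnj (g (p 0)) * G1 0)" and ?d = "1 - (cmod (g (p 0)))\<^sup>2"
      and ?B = "2 * (cmod (G1 0))\<^sup>2 + 2 * Re (cnj (g (p 0)) * G2 0)"
    have "((\<lambda>s. - (2 * Re (cnj (g (p s)) * G1 s)) / (1 - (cmod (g (p s)))\<^sup>2)) has_real_derivative
        (- ?B * ?d - - ?A * (0 - ?A)) / (?d * ?d)) (at 0)"
      by (rule DERIV_divide[OF DERIV_minus[OF u2] DERIV_diff[OF DERIV_const u1]])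
        (use \<open>p 0 \<in> U\<close> pos[OF \<open>p 0 \<in> U\<close>] in auto)
    moreover have "(- B * d - - A * (0 - A)) / (d * d) = - B / d - A\<^sup>2 / d\<^sup>2" if "d > 0" for A B d :: real
      using that by (simp add: field_simps power2_eq_square)
    ultimately show ?thesis
      by (simp only: pos[OF \<open>p 0 \<in> U\<close>])
  qed
  ultimately show ?thesis
    unfolding has_second_deriv0_def p_def G1_def G2_def by auto
qed

text \<open>Adding the directions 1 and \<open>\<i>\<close> cancels the terms in \<open>g''\<close>,
  since \<open>e^2\<close> changes sign, and the squared real and imaginary parts of
  \<open>cnj g * g'\<close> combine to \<open>|g|^2 |g'|^2\<close>. What remains is the pullback of
  the Poincare density.\<close>

lemma laplacian_ln_one_minus_norm:
  assumes g: "g holomorphic_on U" "open U" "w \<in> U" and less1: "\<And>z. z \<in> U \<Longrightarrow> cmod (g z) < 1"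
  obtains D where "\<And>e. has_second_deriv0 (\<lambda>s. ln (1 - (cmod (g (w + e * of_real s)))\<^sup>2)) (D e)"
    and "D 1 + D \<i> = - 4 * ((cmod (deriv g w))\<^sup>2 / (1 - (cmod (g w))\<^sup>2)\<^sup>2)"
proof -
  define G where "G = g w"
  define A where "A = deriv g w"
  define B where "B = deriv (deriv g) w"
  define D where "D e = - (2 * (cmod (A * e))\<^sup>2 + 2 * Re (cnj G * (B * e\<^sup>2))) / (1 - (cmod G)\<^sup>2)
     - (2 * Re (cnj G * (A * e)))\<^sup>2 / (1 - (cmod G)\<^sup>2)\<^sup>2" for e
  define d where "d = 1 - (cmod G)\<^sup>2"
  have "d > 0" using less1[OF g(3)] by (simp add: d_def G_def abs_square_less_1)
  define R where "R = Re (cnj G * A)"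
  define I where "I = Im (cnj G * A)"
  have "R\<^sup>2 + I\<^sup>2 = (cmod (cnj G * A))\<^sup>2"
    unfolding cmod_power2 R_def I_def ..
  then have RI: "R\<^sup>2 + I\<^sup>2 = (1 - d) * (cmod A)\<^sup>2"
    by (simp add: norm_mult power_mult_distrib d_def)
  have "D 1 = - (2 * (cmod A)\<^sup>2 + 2 * Re (cnj G * B)) / d - 4 * R\<^sup>2 / d\<^sup>2"
    unfolding D_def R_def d_def power_mult_distrib by simp
  moreover have "D \<i> = - (2 * (cmod A)\<^sup>2 - 2 * Re (cnj G * B)) / d - 4 * I\<^sup>2 / d\<^sup>2"
  proof -
    have "Re (cnj G * (A * \<i>)) = - I" by (simp add: I_def algebra_simps)
    then show ?thesis
      unfolding D_def d_def power_mult_distrib by (simp add: norm_mult)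
  qed
  ultimately have "D 1 + D \<i> = - (4 * (cmod A)\<^sup>2) / d - 4 * (R\<^sup>2 + I\<^sup>2) / d\<^sup>2"
    by (simp add: add_divide_distrib diff_divide_distrib algebra_simps)
  also have "\<dots> = - 4 * ((cmod A)\<^sup>2 / d\<^sup>2)"
    using \<open>d > 0\<close> unfolding RI by (simp add: field_simps power2_eq_square)
  finally have "D 1 + D \<i> = - 4 * ((cmod A)\<^sup>2 / d\<^sup>2)" .
  moreover have "has_second_deriv0 (\<lambda>s. ln (1 - (cmod (g (w + e * of_real s)))\<^sup>2)) (D e)" for e
    unfolding D_def G_def A_def B_def
    by (rule has_second_deriv0_ln_one_minus_norm[OF g less1])
  ultimately show ?thesis
    using that unfolding d_def A_def G_def by blast
qed

section \<open>Levi forms and the isometry equation on coordinate discs\<close>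

lemma levi_diag_axis:
  assumes "has_second_deriv0 (\<lambda>s. \<phi> (axis i (w + 1 * of_real s))) D"
    and "has_second_deriv0 (\<lambda>s. \<phi> (axis i (w + \<i> * of_real s))) E"
  shows "levi_diag \<phi> (axis i w) (axis i 1) = D + E"
proof -
  have "axis i w + cvscale c (axis i 1) = axis i (w + c)" for c
    by (simp add: vec_eq_iff axis_def cvscale_def)
  then show ?thesis
    using has_second_deriv0_imp_deriv[OF assms(1)] has_second_deriv0_imp_deriv[OF assms(2)]
    by (simp add: levi_diag_def)
qed

lemma norm_axis_complex: "norm (axis i w :: complex^'n) = cmod w"
proof -
  have "(norm (axis i w :: complex^'n))\<^sup>2 = (\<Sum>j\<in>UNIV. if j = i then (cmod w)\<^sup>2 else 0)"
    unfolding norm_vec_power2 by (rule sum.cong) (auto simp: axis_def)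
  then show ?thesis by (simp add: power2_eq_imp_eq)
qed

lemma eventually_line_in_unit_disc:
  fixes w e :: complex
  assumes "cmod w < 1"
  shows "\<forall>\<^sub>F s in nhds (0::real). cmod (w + e * of_real s) < 1"
proof -
  have "((\<lambda>s::real. cmod (w + e * of_real s)) \<longlongrightarrow> cmod (w + e * of_real 0)) (nhds 0)"
    by (intro tendsto_intros) (simp add: filterlim_ident)
  then show ?thesis
    using assms by (intro order_tendstoD(2)) auto
qed

text \<open>Along a coordinate disc the isometry condition reads
  \<open>(m + 1) (1 / (1 - |w|\<^sup>2)\<^sup>2 + |h'|\<^sup>2 / (1 - |h|\<^sup>2)\<^sup>2) = c (n + 1) / (1 - |w|\<^sup>2)\<^sup>2\<close>. The critical point of \<open>h\<close>
  at 0 determines \<open>c\<close>, and then \<open>h'\<close> vanishes identically.\<close>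
lemma holomorphic_isometry_disc_constant:
  fixes F :: "complex^'n \<Rightarrow> complex^'m^'m"
  assumes iso: "holomorphic_isometry F"
    and h: "h holomorphic_on ball 0 1" and less1: "\<And>w. cmod w < 1 \<Longrightarrow> cmod (h w) < 1"
    and crit: "deriv h 0 = 0"
    and det: "\<And>w. cmod w < 1 \<Longrightarrow>
      Re (det (mat 1 - F (axis i w) ** conj_transpose (F (axis i w))))
        = (1 - (cmod w)\<^sup>2) * (1 - (cmod (h w))\<^sup>2)"
  shows "\<exists>c. \<forall>w\<in>ball 0 1. h w = c"
proof -
  define m where "m = real CARD('m) + 1"
  define n where "n = real CARD('n) + 1"
  have "m > 0" "n > 0" by (simp_all add: m_def n_def)
  obtain c where c: "\<And>z v. z \<in> unit_ball \<Longrightarrow>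
      levi_diag (\<lambda>w. ln (typeIII_bergman (F w))) z v = c * levi_diag (\<lambda>w. ln (ball_bergman w)) z v"
    using iso unfolding holomorphic_isometry_def by blast
  have pos: "1 - (cmod p)\<^sup>2 > 0" "1 - (cmod (h p))\<^sup>2 > 0" if "cmod p < 1" for p
    using that less1[OF that] by (simp_all add: abs_square_less_1)
  have eq: "m * (1 / (1 - (cmod w)\<^sup>2)\<^sup>2 + (cmod (deriv h w))\<^sup>2 / (1 - (cmod (h w))\<^sup>2)\<^sup>2)
      = c * n * (1 / (1 - (cmod w)\<^sup>2)\<^sup>2)" if w: "cmod w < 1" for w
  proof -
    obtain D where D: "\<And>e. has_second_deriv0 (\<lambda>s. ln (1 - (cmod (h (w + e * of_real s)))\<^sup>2)) (D e)"
      "D 1 + D \<i> = - 4 * ((cmod (deriv h w))\<^sup>2 / (1 - (cmod (h w))\<^sup>2)\<^sup>2)"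
      using laplacian_ln_one_minus_norm[OF h open_ball, of w] w less1 by auto
    obtain E where E: "\<And>e. has_second_deriv0 (\<lambda>s. ln (1 - (cmod (w + e * of_real s))\<^sup>2)) (E e)"
      "E 1 + E \<i> = - 4 * (1 / (1 - (cmod w)\<^sup>2)\<^sup>2)"
      using laplacian_ln_one_minus_norm[of "\<lambda>w. w" "ball 0 1" w] w by auto
    have "has_second_deriv0 (\<lambda>s. ln (typeIII_bergman (F (axis i (w + e * of_real s))))) (- m * (E e + D e))"
      for e
    proof (rule has_second_deriv0_cong[OF has_second_deriv0_affine[OF E(1) D(1), where a = 0]])
      show "\<forall>\<^sub>F s in nhds 0. 0 + - m * (ln (1 - (cmod (w + e * of_real s))\<^sup>2)
            + ln (1 - (cmod (h (w + e * of_real s)))\<^sup>2))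
          = ln (typeIII_bergman (F (axis i (w + e * of_real s))))"
        using eventually_line_in_unit_disc[OF w, of e]
      proof eventually_elim
        case (elim s)
        then show ?case
          using pos[OF elim]
          by (simp add: typeIII_bergman_def det ln_powr ln_mult m_def)
      qed
    qed
    from levi_diag_axis[OF this this]
    have "levi_diag (\<lambda>w. ln (typeIII_bergman (F w))) (axis i w) (axis i 1)
        = - m * ((E 1 + E \<i>) + (D 1 + D \<i>))"
      by (simp only: ring_distribs)
    also have "\<dots> = 4 * (m * (1 / (1 - (cmod w)\<^sup>2)\<^sup>2 + (cmod (deriv h w))\<^sup>2 / (1 - (cmod (h w))\<^sup>2)\<^sup>2))"
      unfolding D(2) E(2) by (simp add: algebra_simps)
    finally have 1: "levi_diag (\<lambda>w. ln (typeIII_bergman (F w))) (axis i w) (axis i 1)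
      = 4 * (m * (1 / (1 - (cmod w)\<^sup>2)\<^sup>2 + (cmod (deriv h w))\<^sup>2 / (1 - (cmod (h w))\<^sup>2)\<^sup>2))" .
    \<comment> \<open>The normalizing constant of the kernel enters the logarithm additively, so it
      disappears from the Levi form.\<close>
    define k :: real where "k = fact CARD('n) / pi ^ CARD('n)"
    have "k > 0" by (simp add: k_def)
    have "has_second_deriv0 (\<lambda>s. ln (ball_bergman (axis i (w + e * of_real s) :: complex^'n))) (- n * (E e + 0))"
      for e
    proof (rule has_second_deriv0_cong[OF
          has_second_deriv0_affine[OF E(1) has_second_deriv0_const[of 0], where a = "ln k"]])
      show "\<forall>\<^sub>F s in nhds 0. ln k + - n * (ln (1 - (cmod (w + e * of_real s))\<^sup>2) + 0)
          = ln (ball_bergman (axis i (w + e * of_real s) :: complex^'n))"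
        using eventually_line_in_unit_disc[OF w, of e]
      proof eventually_elim
        case (elim s)
        then show ?case
          using pos[OF elim] \<open>k > 0\<close>
          by (simp add: ball_bergman_def norm_axis_complex k_def[symmetric] ln_powr ln_mult n_def)
      qed
    qed
    from levi_diag_axis[OF this this]
    have "levi_diag (\<lambda>w. ln (ball_bergman w)) (axis i w :: complex^'n) (axis i 1) = - n * (E 1 + E \<i>)"
      by (simp only: ring_distribs add_0_right)
    also have "\<dots> = 4 * (n * (1 / (1 - (cmod w)\<^sup>2)\<^sup>2))"
      unfolding E(2) by simp
    finally have 2: "levi_diag (\<lambda>w. ln (ball_bergman w)) (axis i w :: complex^'n) (axis i 1)
      = 4 * (n * (1 / (1 - (cmod w)\<^sup>2)\<^sup>2))" .
    have "(axis i w :: complex^'n) \<in> unit_ball"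
      using w by (simp add: unit_ball_def norm_axis_complex)
    note 3 = c[OF this, of "axis i 1", unfolded 1 2]
    have cancel: "4 * x = k * (4 * y) \<Longrightarrow> x = k * y" for x y k :: real
      by simp
    show ?thesis
      using cancel[OF 3] unfolding mult.assoc .
  qed
  from eq[of 0] have "c * n = m"
    by (simp add: crit)
  have "deriv h w = 0" if w: "cmod w < 1" for w
    using eq[OF w] \<open>c * n = m\<close> \<open>m > 0\<close> pos[OF w] by (simp add: ring_distribs)
  then have "(h has_field_derivative 0) (at w within ball 0 1)" if "w \<in> ball 0 1" for w
    using holomorphic_derivI[OF h open_ball that, of "ball 0 1"] that by simp
  then show ?thesis
    using has_field_derivative_zero_constant[of "ball 0 1" h] convex_ball by blast
qed

text \<open>For \<open>x = 0\<close> the block matrix is diagonal with entries \<open>w\<close>,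
  \<open>\<eta>\<close> and zeros. This is the situation on a coordinate disc.\<close>

lemma det_siegel_block_diagonal:
  fixes a b :: "'m::finite" and w \<eta> :: complex
  assumes "a \<noteq> b"
  defines "M \<equiv> siegel_block a b w 0 \<eta>"
  shows "Re (det (mat 1 - M ** conj_transpose M)) = (1 - (cmod w)\<^sup>2) * (1 - (cmod \<eta>)\<^sup>2)"
proof -
  define f where "f j = (if j = a then w else if j = b then \<eta> else 0)" for j
  have M: "M$j$k = (if j = k then f j else 0)" for j k
    using assms(1) by (auto simp: M_def siegel_block_def f_def)
  have MM: "(mat 1 - M ** conj_transpose M)$j$k
      = (if j = k then of_real (1 - (cmod (f j))\<^sup>2) else 0)" for j k
  proof -
    have "(\<Sum>l\<in>UNIV. M$j$l * cnj (M$k$l)) = (\<Sum>l\<in>UNIV. if l = j then f j * cnj (M$k$j) else 0)"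
      by (rule sum.cong) (auto simp: M)
    then have "(M ** conj_transpose M)$j$k = f j * cnj (M$k$j)"
      by (simp add: matrix_matrix_mult_def conj_transpose_def)
    then show ?thesis
      by (auto simp: mat_def M complex_norm_square[symmetric])
  qed
  have "det (mat 1 - M ** conj_transpose M) = (\<Prod>j\<in>UNIV. (mat 1 - M ** conj_transpose M)$j$j)"
    by (rule det_diagonal) (simp only: MM if_False)
  also have "\<dots> = of_real (\<Prod>j\<in>UNIV. 1 - (cmod (f j))\<^sup>2)"
    unfolding MM by simp
  also have "(\<Prod>j\<in>UNIV. 1 - (cmod (f j))\<^sup>2)
      = (\<Prod>j\<in>UNIV. (if j = a then 1 - (cmod w)\<^sup>2 else 1) * (if j = b then 1 - (cmod \<eta>)\<^sup>2 else 1))"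
    by (rule prod.cong) (use assms(1) in \<open>auto simp: f_def\<close>)
  also have "\<dots> = (1 - (cmod w)\<^sup>2) * (1 - (cmod \<eta>)\<^sup>2)"
    by (simp add: prod.distrib)
  finally show ?thesis
    by (simp only: Re_complex_of_real)
qed

section \<open>The map on the ball\<close>

text \<open>The coordinates other than \<open>i\<close>, moved to matrix positions by
  \<open>\<iota>\<close>. The factor \<open>1 / sqrt 2\<close> turns the form
  \<open>|c|^2 + 2 |x|^2\<close> of the block map into \<open>|z|^2\<close>.\<close>

definition tail_vec :: "('n \<Rightarrow> 'm) \<Rightarrow> 'n \<Rightarrow> complex^'n \<Rightarrow> complex^'m" where
  "tail_vec \<iota> i z = (\<chi> j. if j \<in> \<iota> ` (- {i}) then z $ inv \<iota> j / of_real (sqrt 2) else 0)"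

lemma tail_vec_eq_0:
  assumes "inj \<iota>"
  shows "tail_vec \<iota> i z $ \<iota> i = 0" and "b \<notin> range \<iota> \<Longrightarrow> tail_vec \<iota> i z $ b = 0"
    and "tail_vec \<iota> i (axis i w) = 0"
  using assms by (auto simp: tail_vec_def inj_image_mem_iff vec_eq_iff axis_def)

lemma norm_tail_vec:
  fixes \<iota> :: "'n::finite \<Rightarrow> 'm::finite"
  assumes "inj \<iota>"
  shows "(cmod (z$i))\<^sup>2 + 2 * (norm (tail_vec \<iota> i z))\<^sup>2 = (norm z)\<^sup>2"
proof -
  have "(norm (tail_vec \<iota> i z))\<^sup>2 = (\<Sum>j\<in>\<iota> ` (- {i}). (cmod (z $ inv \<iota> j))\<^sup>2 / 2)"
    unfolding norm_vec_power2
    by (rule sum.mono_neutral_cong_right) (auto simp: tail_vec_def norm_divide power_divide)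
  also have "\<dots> = (\<Sum>k\<in>- {i}. (cmod (z $ k))\<^sup>2 / 2)"
    using assms by (subst sum.reindex) (auto intro: inj_on_subset)
  finally have "2 * (norm (tail_vec \<iota> i z))\<^sup>2 = (\<Sum>k\<in>- {i}. (cmod (z $ k))\<^sup>2)"
    by (simp add: sum_divide_distrib[symmetric])
  moreover have "(norm z)\<^sup>2 = (cmod (z$i))\<^sup>2 + (\<Sum>k\<in>- {i}. (cmod (z $ k))\<^sup>2)"
    unfolding norm_vec_power2 Compl_eq_Diff_UNIV by (rule sum.remove) auto
  ultimately show ?thesis by simp
qed

lemma continuous_on_tail_vec: "continuous_on S (tail_vec \<iota> i)"
  unfolding tail_vec_def[abs_def]
proof (rule continuous_on_vec_lambda)
  fix j
  show "continuous_on S (\<lambda>z. if j \<in> \<iota> ` (- {i}) then z $ inv \<iota> j / of_real (sqrt 2) else 0)"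
    by (cases "j \<in> \<iota> ` (- {i})") (auto intro!: continuous_intros)
qed

section \<open>Holomorphy, properness and isometry obstruction for the block map\<close>

lemma unit_ball_iff: "z \<in> unit_ball \<longleftrightarrow> norm z < 1"
  by (simp add: unit_ball_def)

lemma holo_map_imp_isCont:
  assumes "holo_map F U" "z \<in> U"
  shows "isCont F z"
  using assms has_derivative_continuous unfolding holo_map_def by blast

context
  fixes \<iota> :: "'n::finite \<Rightarrow> 'm::finite" and i :: 'n and b :: 'm and h :: "complex^'n \<Rightarrow> complex"
    and F :: "complex^'n \<Rightarrow> complex^'m^'m"
  assumes inj: "inj \<iota>" and b: "b \<notin> range \<iota>"
    and h: "\<And>z. norm z < 1 \<Longrightarrow> cplx_diff h z" and less1: "\<And>z. norm z < 1 \<Longrightarrow> cmod (h z) < 1"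
  defines "F \<equiv> \<lambda>z. siegel_block (\<iota> i) b (z$i) (tail_vec \<iota> i z) (h z)"
begin

lemma siegel_map_sides: "\<iota> i \<noteq> b" "tail_vec \<iota> i z $ \<iota> i = 0" "tail_vec \<iota> i z $ b = 0"
  using b tail_vec_eq_0[OF inj] by auto

lemma siegel_map_in_typeIII_domain:
  assumes "norm z < 1"
  shows "F z \<in> typeIII_domain"
  unfolding F_def
proof (rule siegel_block_in_typeIII_domain)
  show "(cmod (z$i))\<^sup>2 + 2 * (norm (tail_vec \<iota> i z))\<^sup>2 < 1"
    using assms by (simp add: norm_tail_vec[OF inj] abs_square_less_1)
qed (use siegel_map_sides less1[OF assms] in auto)

lemma holo_map_siegel_map: "holo_map F unit_ball"
proof (rule holo_mapI)
  fix z :: "complex^'n" and j k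
  assume "z \<in> unit_ball"
  then have z: "norm z < 1" by (simp add: unit_ball_iff)
  have "z$i \<noteq> 1"
    using Finite_Cartesian_Product.norm_nth_le[of z i] z by auto
  have x: "cplx_diff (\<lambda>z. tail_vec \<iota> i z $ l) z" for l
  proof (cases "l \<in> \<iota> ` (- {i})")
    case True
    then show ?thesis
      by (simp add: tail_vec_def divide_inverse cplx_diff_mult cplx_diff_nth cplx_diff_const)
  qed (simp add: tail_vec_def cplx_diff_const)
  have "(\<lambda>w. - inverse (1 - w)) field_differentiable at (z$i)"
    using \<open>z$i \<noteq> 1\<close> by (intro derivative_intros) auto
  then have "cplx_diff (\<lambda>z. - inverse (1 - z$i)) z"
    by (rule cplx_diff_compose[OF cplx_diff_nth])
  from cplx_diff_mult[OF cplx_diff_mult[OF x x] this]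
  have xx: "cplx_diff (\<lambda>z. - (tail_vec \<iota> i z $ j * tail_vec \<iota> i z $ k / (1 - z$i))) z"
    by (simp add: divide_inverse)
  consider "j = \<iota> i" "k = \<iota> i" | "j = \<iota> i" "k \<noteq> \<iota> i" | "j \<noteq> \<iota> i" "k = \<iota> i"
    | "j \<noteq> \<iota> i" "k \<noteq> \<iota> i" "j = b \<and> k = b" | "j \<noteq> \<iota> i" "k \<noteq> \<iota> i" "\<not> (j = b \<and> k = b)"
    by blast
  then show "cplx_diff (\<lambda>z. F z $ j $ k) z"
    by cases (simp_all add: F_def siegel_block_def cplx_diff_nth x xx h[OF z] del: de_Morgan_conj)
qed

text \<open>A sequence in the preimage of \<open>K\<close> has a subsequence along which the points
  tend to some \<open>z\<close> in the closed ball and the images to some \<open>Y\<close> in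
  \<open>K\<close>. If \<open>|z| = 1\<close>, the test vectors show that \<open>Y\<close> preserves
  the norm of a nonzero vector, which no point of the domain does. Compactness of \<open>K\<close>
  supplies \<open>Y\<close> without any boundary limit of \<open>h\<close>.\<close>

lemma proper_into_siegel_map: "proper_into F unit_ball typeIII_domain"
  unfolding proper_into_def
proof (intro conjI allI impI)
  show "F ` unit_ball \<subseteq> typeIII_domain"
    using siegel_map_in_typeIII_domain by (auto simp: unit_ball_iff)
  fix K :: "(complex^'m^'m) set"
  assume K: "K \<subseteq> typeIII_domain \<and> compact K"
  show "compact (unit_ball \<inter> F -` K)"
    unfolding compact_def
  proof (intro allI impI)
    fix f :: "nat \<Rightarrow> complex^'n"
    assume f: "\<forall>n. f n \<in> unit_ball \<inter> F -` K"
    then have f1: "norm (f n) < 1" and fK: "F (f n) \<in> K" for n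
      by (auto simp: unit_ball_iff)
    have "compact (cball (0::complex^'n) 1 \<times> K)"
      using K by (intro compact_Times) auto
    moreover have "\<forall>n. (f n, F (f n)) \<in> cball 0 1 \<times> K"
      using f1 fK less_imp_le by auto
    ultimately obtain l r where l: "l \<in> cball 0 1 \<times> K" and r: "strict_mono r"
      and lim: "((\<lambda>n. (f n, F (f n))) \<circ> r) \<longlonglongrightarrow> l"
      unfolding compact_def by (metis (no_types, lifting))
    obtain z Y where zY: "l = (z, Y)" by (cases l)
    have "Y \<in> K" "norm z \<le> 1" using l zY by auto
    have limz: "(\<lambda>n. f (r n)) \<longlonglongrightarrow> z" and limY: "(\<lambda>n. F (f (r n))) \<longlonglongrightarrow> Y"
      using tendsto_fst[OF lim] tendsto_snd[OF lim] by (simp_all add: zY o_def)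
    have Y: "(norm (Y *v w))\<^sup>2 < (norm w)\<^sup>2" if "w \<noteq> 0" for w
      using K \<open>Y \<in> K\<close> that typeIII_domain_iff by blast
    have "norm z \<noteq> 1"
    proof
      assume "norm z = 1"
      have "(\<lambda>n. F (f (r n)) $ \<iota> i $ \<iota> i) \<longlonglongrightarrow> Y $ \<iota> i $ \<iota> i"
        by (intro tendsto_intros limY)
      moreover have "(\<lambda>n. F (f (r n)) $ \<iota> i $ \<iota> i) = (\<lambda>n. f (r n) $ i)"
        by (simp add: F_def siegel_block_def)
      moreover have "(\<lambda>n. f (r n) $ i) \<longlonglongrightarrow> z $ i"
        by (intro tendsto_intros limz)
      ultimately have Yz: "Y $ \<iota> i $ \<iota> i = z $ i"
        using LIMSEQ_unique by metis
      \<comment> \<open>At \<open>z $ i = 1\<close> the test vector degenerates to zero; there the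
        diagonal entry 1 of \<open>Y\<close> already contradicts contraction on a basis
        vector.\<close>
      have "z $ i \<noteq> 1"
      proof
        assume "z $ i = 1"
        have "(Y *v axis (\<iota> i) 1) $ \<iota> i = 1"
          using Yz \<open>z $ i = 1\<close> by (simp add: matrix_vector_mult_def axis_def if_distrib cong: if_cong)
        then have "1 \<le> norm (Y *v axis (\<iota> i) 1)"
          using Finite_Cartesian_Product.norm_nth_le by (metis norm_one)
        moreover have "(norm (Y *v axis (\<iota> i) 1))\<^sup>2 < (norm (axis (\<iota> i) (1::complex)))\<^sup>2"
          by (rule Y) (simp add: axis_eq_0_iff)
        ultimately show False
          by (simp add: norm_axis_complex abs_square_less_1)
      qed
      define v where "v z = siegel_test_vec (\<iota> i) (z$i) (tail_vec \<iota> i z)" for z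
      have "v z \<noteq> 0"
        unfolding v_def using siegel_map_sides \<open>z $ i \<noteq> 1\<close> by (intro siegel_test_vec_nonzero) auto
      have "continuous_on UNIV v"
        unfolding v_def[abs_def] siegel_test_vec_def
      proof (rule continuous_on_vec_lambda)
        fix j
        show "continuous_on UNIV (\<lambda>z. if j = \<iota> i
           then cnj (1 - z$i) - of_real ((norm (tail_vec \<iota> i z))\<^sup>2)
           else - (1 - z$i) * cnj (tail_vec \<iota> i z $ j))"
          by (cases "j = \<iota> i") (auto intro!: continuous_intros continuous_on_tail_vec)
      qed
      then have "isCont v z"
        by (simp add: continuous_on_eq_continuous_at)
      then have limv: "(\<lambda>n. v (f (r n))) \<longlonglongrightarrow> v z"
        using limz by (rule isCont_tendsto_compose)
      have "(\<lambda>n. F (f (r n)) *v v (f (r n))) \<longlonglongrightarrow> Y *v v z"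
        unfolding matrix_vector_mult_def
        by (intro tendsto_vec_lambda tendsto_sum tendsto_mult tendsto_vec_nth limY limv)
      then have "(\<lambda>n. (norm (v (f (r n))))\<^sup>2 - (norm (F (f (r n)) *v v (f (r n))))\<^sup>2)
          \<longlonglongrightarrow> (norm (v z))\<^sup>2 - (norm (Y *v v z))\<^sup>2"
        by (intro tendsto_intros limv)
      moreover have "(norm (v y))\<^sup>2 - (norm (F y *v v y))\<^sup>2 = (cmod (1 - y$i))\<^sup>2 * (1 - (norm y)\<^sup>2)"
        if "norm y < 1" for y
      proof -
        have "y$i \<noteq> 1" using Finite_Cartesian_Product.norm_nth_le that by (metis norm_one not_le)
        then show ?thesis
          unfolding v_def F_def norm_tail_vec[OF inj, of y i, symmetric]
          by (simp add: siegel_block_test_vec siegel_map_sides)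
      qed
      ultimately have "(\<lambda>n. (cmod (1 - f (r n) $ i))\<^sup>2 * (1 - (norm (f (r n)))\<^sup>2))
          \<longlonglongrightarrow> (norm (v z))\<^sup>2 - (norm (Y *v v z))\<^sup>2"
        using f1 by simp
      moreover have "(\<lambda>n. (cmod (1 - f (r n) $ i))\<^sup>2 * (1 - (norm (f (r n)))\<^sup>2))
          \<longlonglongrightarrow> (cmod (1 - z $ i))\<^sup>2 * (1 - (norm z)\<^sup>2)"
        by (intro tendsto_intros limz)
      ultimately have "(norm (v z))\<^sup>2 - (norm (Y *v v z))\<^sup>2 = 0"
        using LIMSEQ_unique \<open>norm z = 1\<close> by fastforce
      then show False
        using Y[OF \<open>v z \<noteq> 0\<close>] by simp
    qed
    then have "norm z < 1" using \<open>norm z \<le> 1\<close> by simp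
    then have "isCont F z"
      using holo_map_siegel_map by (simp add: holo_map_imp_isCont unit_ball_iff)
    then have "(\<lambda>n. F (f (r n))) \<longlonglongrightarrow> F z"
      using limz by (rule isCont_tendsto_compose)
    then have "F z = Y" using limY LIMSEQ_unique by blast
    then show "\<exists>l\<in>unit_ball \<inter> F -` K. \<exists>r. strict_mono r \<and> (f \<circ> r) \<longlonglongrightarrow> l"
      using \<open>Y \<in> K\<close> \<open>norm z < 1\<close> r limz by (auto simp: unit_ball_iff o_def)
  qed
qed

text \<open>On the \<open>i\<close>-th coordinate disc the tail vanishes and \<open>F\<close> is
  diagonal, so the determinant factors. Evenness of \<open>h\<close> gives \<open>D = - D\<close>
  for the derivative at 0, which is the required critical point.\<close>

lemma holomorphic_isometry_siegel_map_constant: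
  assumes "holomorphic_isometry F" and even: "\<And>z. h (- z) = h z"
  shows "\<exists>c. \<forall>w\<in>ball 0 1. h (axis i w) = c"
proof (rule holomorphic_isometry_disc_constant[OF assms(1), where i = i])
  have fd: "(\<lambda>w. h (axis i w)) field_differentiable at w" if "cmod w < 1" for w
    by (intro cplx_diff_axis_field_differentiable h) (simp add: norm_axis_complex that)
  then show "(\<lambda>w. h (axis i w)) holomorphic_on ball 0 1"
    unfolding holomorphic_on_def by (auto intro: field_differentiable_at_within)
  show "cmod (h (axis i w)) < 1" if "cmod w < 1" for w
    by (rule less1) (simp add: norm_axis_complex that)
  show "deriv (\<lambda>w. h (axis i w)) 0 = 0"
  proof -
    define D where "D = deriv (\<lambda>w. h (axis i w)) 0"
    have D: "((\<lambda>w. h (axis i w)) has_field_derivative D) (at 0)"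
      unfolding D_def using fd[of 0] by (simp add: field_differentiable_derivI)
    have "((\<lambda>w::complex. - w) has_field_derivative - 1) (at 0)"
      by (auto intro!: derivative_eq_intros)
    from DERIV_chain2[of "\<lambda>w. h (axis i w)" D "\<lambda>w. - w" 0, OF _ this] D
    have "((\<lambda>w. h (axis i (- w))) has_field_derivative - D) (at 0)"
      by simp
    moreover have "h (axis i (- w)) = h (axis i w)" for w
    proof -
      have "(axis i (- w) :: complex^'n) = - axis i w" by (simp add: axis_def vec_eq_iff)
      then show ?thesis by (simp add: even)
    qed
    ultimately have "((\<lambda>w. h (axis i w)) has_field_derivative - D) (at 0)" by simp
    then have "D = - D" using D DERIV_unique by blast
    then show ?thesis by (simp add: D_def)
  qed
  show "Re (det (mat 1 - F (axis i w) ** conj_transpose (F (axis i w))))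
      = (1 - (cmod w)\<^sup>2) * (1 - (cmod (h (axis i w)))\<^sup>2)" for w
    unfolding F_def tail_vec_eq_0(3)[OF inj] axis_nth
    by (rule det_siegel_block_diagonal) (use siegel_map_sides in auto)
qed

end

section \<open>Choice of the singular points and conclusion\<close>

lemma sqrt_series_even: "sqrt_series \<zeta> (- z) = sqrt_series \<zeta> z"
proof -
  have "cdot (- z) w = - cdot z w" for w
    by (simp add: cdot_def sum_negf)
  then show ?thesis by (simp add: sqrt_series_def)
qed

theorem mainTheorem16:
  assumes "CARD('m::finite) \<ge> CARD('n::finite) + 1"
  shows "\<exists>F :: complex^'n \<Rightarrow> complex^'m^'m.
           holo_map F unit_ball \<and> proper_into F unit_ball typeIII_domain \<and>
           \<not> C2_extends_to_boundary_piece F \<and> \<not> holomorphic_isometry F"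
proof -
  obtain \<iota> :: "'n \<Rightarrow> 'm" where inj: "inj \<iota>"
    using assms card_le_inj[of "UNIV :: 'n set" "UNIV :: 'm set"] by auto
  have "card (range \<iota>) < CARD('m)"
    using assms inj by (simp add: card_image)
  \<comment> \<open>The spare diagonal slot for \<open>h\<close>; the dimension gap provides
    it.\<close>
  then obtain b where b: "b \<notin> range \<iota>"
    by (metis UNIV_eq_I less_irrefl)
  define i :: 'n where "i = undefined"
  obtain T :: "(complex^'n) set" where T: "countable T" "T \<subseteq> sphere 0 1" "sphere 0 1 \<subseteq> closure T"
    using separable by blast
  \<comment> \<open>Adding \<open>axis i 1\<close> makes \<open>h\<close> singular at the end of a
    radius of the \<open>i\<close>-th coordinate disc, so \<open>h\<close> cannot be constant on
    that disc.\<close>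
  define T' where "T' = insert (axis i 1) T"
  have T': "countable T'" "T' \<noteq> {}" "T' \<subseteq> sphere 0 1"
    using T by (auto simp: T'_def norm_axis_complex)
  define \<zeta> where "\<zeta> = from_nat_into T'"
  have range: "range \<zeta> = T'"
    unfolding \<zeta>_def using T' by (intro range_from_nat_into)
  have \<zeta>: "norm (\<zeta> k) = 1" for k
  proof -
    have "\<zeta> k \<in> sphere 0 1" using T'(3) range by blast
    then show ?thesis by simp
  qed
  define h where "h = sqrt_series \<zeta>"
  have h: "cplx_diff h z" "cmod (h z) < 1" if "norm z < 1" for z
    using that unfolding h_def by (auto intro: cplx_diff_sqrt_series norm_sqrt_series_less \<zeta>)
  define F where "F z = siegel_block (\<iota> i) b (z$i) (tail_vec \<iota> i z) (h z)" for z
  have F: "F = (\<lambda>z. siegel_block (\<iota> i) b (z$i) (tail_vec \<iota> i z) (h z))"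
    by (simp add: F_def[abs_def])
  have Fbb: "F z $ b $ b = h z" for z
    using b by (auto simp: F_def siegel_block_def)
  have "\<not> C2_extends_to_boundary_piece F"
  proof
    assume "C2_extends_to_boundary_piece F"
    then obtain U G where U: "open U" "U \<inter> sphere 0 1 \<noteq> {}" and "C2_on U G"
      and G: "\<And>z. z \<in> U \<inter> ball 0 1 \<Longrightarrow> G z = F z"
      unfolding C2_extends_to_boundary_piece_def by blast
    \<comment> \<open>An open set meeting the sphere contains some \<open>\<zeta> j\<close> by
      density; there the entry of \<open>G\<close> at \<open>b\<close>, which equals
      \<open>h\<close> inside the ball, would be differentiable.\<close>
    have "U \<inter> closure T \<noteq> {}" using U T(3) by blast
    then have "U \<inter> T \<noteq> {}" using U(1) open_Int_closure_eq_empty by blast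
    then obtain j where j: "\<zeta> j \<in> U"
      using range unfolding T'_def by (metis disjoint_iff insertCI rangeE)
    obtain \<epsilon> where "\<epsilon> > 0" and \<epsilon>: "ball (\<zeta> j) \<epsilon> \<subseteq> U"
      using U(1) j open_contains_ball by blast
    have "\<not> (\<lambda>z. G z $ b $ b) differentiable at (\<zeta> j)"
    proof (rule sqrt_series_not_differentiable[OF \<zeta> \<open>\<epsilon> > 0\<close>])
      fix r :: real assume r: "0 \<le> r" "1 - \<epsilon> < r" "r < 1"
      have "\<zeta> j - r *\<^sub>R \<zeta> j = (1 - r) *\<^sub>R \<zeta> j" by (simp add: scaleR_diff_left)
      then have "r *\<^sub>R \<zeta> j \<in> U \<inter> ball 0 1"
        using r \<epsilon> by (auto simp: dist_norm \<zeta>)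
      then show "G (r *\<^sub>R \<zeta> j) $ b $ b = sqrt_series \<zeta> (r *\<^sub>R \<zeta> j)"
        using G by (simp add: Fbb h_def)
    qed
    moreover obtain L where "(G has_derivative L) (at (\<zeta> j))"
      using \<open>C2_on U G\<close> j unfolding C2_on_def by blast
    then have "((\<lambda>z. G z $ b $ b) has_derivative (\<lambda>v. L v $ b $ b)) (at (\<zeta> j))"
      by (intro bounded_linear.has_derivative[OF bounded_linear_vec_nth])
    ultimately show False
      unfolding differentiable_def by blast
  qed
  moreover have "\<not> holomorphic_isometry F"
  proof
    assume "holomorphic_isometry F"
    then obtain c where c: "\<And>w. w \<in> ball 0 1 \<Longrightarrow> h (axis i w) = c"
      using holomorphic_isometry_siegel_map_constant[OF inj b h, of i, folded F]
        sqrt_series_even unfolding h_def by blast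
    obtain j where j: "\<zeta> j = axis i 1"
      using range by (metis T'_def insertI1 rangeE)
    \<comment> \<open>The constant agrees with \<open>h\<close> on the radius towards
      \<open>axis i 1\<close>, so the non-differentiability result would apply to a constant
      function.\<close>
    have "\<not> (\<lambda>z. c) differentiable at (\<zeta> j)"
    proof (rule sqrt_series_not_differentiable[OF \<zeta> zero_less_one])
      fix r :: real assume r: "0 \<le> r" "r < 1"
      have "r *\<^sub>R \<zeta> j = axis i (of_real r)"
        by (simp add: j axis_def vec_eq_iff) (simp add: scaleR_conv_of_real)
      then show "c = sqrt_series \<zeta> (r *\<^sub>R \<zeta> j)"
        using c[of "of_real r"] r by (simp add: h_def)
    qed
    then show False by simp
  qed
  ultimately show ?thesis
    using holo_map_siegel_map[OF inj b h, of i, folded F]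
      proper_into_siegel_map[OF inj b h, of i, folded F] by blast
qed

end
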